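(* Let $g$ be a derivator, $X$ a compact subset of $\mathbb R_+$ and $n\in\mathbb N$. Suppose $\#g(X)\ge n+2$. Let $f\in\operatorname{C}_g(X,\mathbb R)$ and $p\in\operatorname{P}_n(\mathbb R)$, and let $\|\cdot\|_\infty$ be the supremum norm on $X$. Then the following are equivalent: I. $p$ is the best approximation of $f$ in $\operatorname{P}_n(\mathbb R)$, that is, $\|f-p\|_\infty=\inf_{q\in\operatorname{P}_n(\mathbb R)}\|f-q\|_\infty$. II. There exist $t_1<_g\cdots<_g t_{n+2}$ in $X$ such that $$|f(t_i)-p(t_i)|=\|f-p\|_\infty,\quad i\in\{1,\dots,n+2\},$$ $$f(t_i)-p(t_i)=-(f(t_{i+1})-p(t_{i+1})),\quad i\in\{1,\dots,n+1\}.$$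
   Context: $\mathbb N=\{0,1,2,\dots\}$; $\#$ denotes cardinality. A derivator is a left-continuous nondecreasing function $g:\mathbb R\to\mathbb R$; $\mu_g$ is the Lebesgue–Stieltjes measure with $\mu_g([a,b))=g(b)-g(a)$. Write $g(t^+)$ for the right-hand limit and $D_g=\{t\in\mathbb R:g(t^+)>g(t)\}$. $\mathbb R_+$ is the disjoint union of $\mathbb R$ and a formal copy $\{t^+:t\in D_g\}$ of $D_g$; $g$ is extended to $\mathbb R_+$ by letting $g(t^+)$ be the right-hand limit of $g$ at $t$. $\mathbb R_+$ carries the pseudometric $d_g(x,y)=|g(x)-g(y)|$ and its topology; $x<_g y$ means $g(x)<g(y)$. $\operatorname{C}_g(X,\mathbb R)$ is the space of real functions on $X$ continuous for this topology. Put $\int_x^y f\,d\mu_g=\int_{[x,y)}f\,d\mu_g$ if $y\ge x$ and $-\int_{[y,x)}f\,d\mu_g$ if $y<x$. For $x_0\in\mathbb R$ the $g$-monomials are $g_{x_0,0}(x)=1$ and $g_{x_0,n}(x)=n\int_{x_0}^x g_{x_0,n-1}\,d\mu_g$ for $n\ge1$, $x\in\mathbb R$. $\operatorname{P}_n(\mathbb R)$ is the real vector space spanned by $g_{x_0,0},\dots,g_{x_0,n}$ (independent of $x_0$); its elements are regarded as functions on $\mathbb R_+$ (hence on $X$), evaluated at $t^+$ ($t\in D_g$) by the right-hand limit at $t$. *)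

theory Defs
  imports "HOL-Analysis.Analysis"
begin

definition derivator :: "(real \<Rightarrow> real) \<Rightarrow> bool" where
  "derivator g \<longleftrightarrow> mono g \<and> (\<forall>t. continuous (at_left t) g)"

text \<open>
  The library's \<open>interval_measure\<close> expects a right-continuous function and measures the intervals
  \<open>{a<..b}\<close>. The measure of a left-continuous \<open>g\<close> is obtained by reflecting the real line;
  \<open>emeasure_stieltjes\<close> below is its characteristic property.
\<close>

definition stieltjes :: "(real \<Rightarrow> real) \<Rightarrow> real measure" where
  "stieltjes g = distr (interval_measure (\<lambda>x. - g (- x))) borel uminus"

lemma sets_stieltjes [simp]: "sets (stieltjes g) = sets borel"
  by (simp add: stieltjes_def)

lemma space_stieltjes [simp]: "space (stieltjes g) = UNIV"
  by (simp add: stieltjes_def)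

lemma emeasure_stieltjes:
  assumes g: "derivator g" and ab: "a \<le> b"
  shows "emeasure (stieltjes g) {a..<b} = ennreal (g b - g a)"
proof -
  have mono: "- g (- x) \<le> - g (- y)" if "x \<le> y" for x y
    using g that by (auto simp: derivator_def mono_def)
  have cont: "continuous (at_right x) (\<lambda>x. - g (- x))" for x
  proof -
    have "(g \<longlongrightarrow> g (- x)) (at_left (- x))"
      using g by (auto simp: derivator_def continuous_within)
    then have "((\<lambda>y. g (- y)) \<longlongrightarrow> g (- x)) (at_right x)"
      by (simp add: filterlim_at_left_to_right)
    then show ?thesis
      by (simp add: continuous_within tendsto_minus)
  qed
  have "emeasure (stieltjes g) {a..<b} =
      emeasure (interval_measure (\<lambda>x. - g (- x))) (uminus -` {a..<b} \<inter> UNIV)"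
    unfolding stieltjes_def by (subst emeasure_distr) auto
  also have "uminus -` {a..<b} \<inter> UNIV = {- b<..- a}"
    by auto
  also have "emeasure (interval_measure (\<lambda>x. - g (- x))) {- b<..- a} = ennreal (g b - g a)"
    using emeasure_interval_measure_Ioc[of "- b" "- a" "\<lambda>x. - g (- x)"] mono cont ab by simp
  finally show ?thesis .
qed

definition right_limit :: "(real \<Rightarrow> real) \<Rightarrow> real \<Rightarrow> real" where
  "right_limit h t = Lim (at_right t) h"

definition jumps :: "(real \<Rightarrow> real) \<Rightarrow> real set" where
  "jumps g = {t. right_limit g t > g t}"

text \<open>
  \<open>Pt t\<close> is the real number \<open>t\<close> and \<open>PtR t\<close> is the formal point \<open>t\<^sup>+\<close>. The space \<open>\<real>\<^sub>+\<close>
  depends on \<open>g\<close>, so it is the subset \<open>Rplus g\<close> of this type.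
\<close>

datatype rpoint = Pt real | PtR real

definition Rplus :: "(real \<Rightarrow> real) \<Rightarrow> rpoint set" where
  "Rplus g = range Pt \<union> PtR ` jumps g"

primrec extend :: "(real \<Rightarrow> real) \<Rightarrow> rpoint \<Rightarrow> real" where
  "extend h (Pt t) = h t"
| "extend h (PtR t) = right_limit h t"

definition gdist :: "(real \<Rightarrow> real) \<Rightarrow> rpoint \<Rightarrow> rpoint \<Rightarrow> real" where
  "gdist g x y = \<bar>extend g x - extend g y\<bar>"

definition gless :: "(real \<Rightarrow> real) \<Rightarrow> rpoint \<Rightarrow> rpoint \<Rightarrow> bool" where
  "gless g x y \<longleftrightarrow> extend g x < extend g y"

text \<open>
  The library's \<open>Metric_space\<close> does not cover pseudometrics, hence the explicit definition by balls.
\<close>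

definition gtopology :: "(real \<Rightarrow> real) \<Rightarrow> rpoint topology" where
  "gtopology g = topology (\<lambda>U. U \<subseteq> Rplus g \<and>
     (\<forall>x\<in>U. \<exists>e>0. \<forall>y\<in>Rplus g. gdist g x y < e \<longrightarrow> y \<in> U))"

lemma openin_gtopology:
  "openin (gtopology g) U \<longleftrightarrow> U \<subseteq> Rplus g \<and>
     (\<forall>x\<in>U. \<exists>e>0. \<forall>y\<in>Rplus g. gdist g x y < e \<longrightarrow> y \<in> U)"
proof -
  have "istopology (\<lambda>U. U \<subseteq> Rplus g \<and>
     (\<forall>x\<in>U. \<exists>e>0. \<forall>y\<in>Rplus g. gdist g x y < e \<longrightarrow> y \<in> U))" (is "istopology ?P")
    unfolding istopology_def
  proof (intro conjI allI impI)
    fix S T assume S: "?P S" and T: "?P T"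
    show "S \<inter> T \<subseteq> Rplus g" using S by auto
    show "\<forall>x\<in>S \<inter> T. \<exists>e>0. \<forall>y\<in>Rplus g. gdist g x y < e \<longrightarrow> y \<in> S \<inter> T"
    proof
      fix x assume x: "x \<in> S \<inter> T"
      obtain d where d: "d > 0" "\<forall>y\<in>Rplus g. gdist g x y < d \<longrightarrow> y \<in> S"
        using S x by blast
      obtain e where e: "e > 0" "\<forall>y\<in>Rplus g. gdist g x y < e \<longrightarrow> y \<in> T"
        using T x by blast
      show "\<exists>e>0. \<forall>y\<in>Rplus g. gdist g x y < e \<longrightarrow> y \<in> S \<inter> T"
        using d e by (intro exI[of _ "min d e"]) auto
    qed
  next
    fix K assume K: "\<forall>U\<in>K. ?P U"
    show "\<Union>K \<subseteq> Rplus g" using K by blast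
    show "\<forall>x\<in>\<Union>K. \<exists>e>0. \<forall>y\<in>Rplus g. gdist g x y < e \<longrightarrow> y \<in> \<Union>K"
      using K by (meson Union_iff)
  qed
  then show ?thesis
    by (simp add: gtopology_def)
qed

lemma topspace_gtopology [simp]: "topspace (gtopology g) = Rplus g"
proof
  show "topspace (gtopology g) \<subseteq> Rplus g"
    using openin_gtopology openin_topspace by blast
  have "openin (gtopology g) (Rplus g)"
    unfolding openin_gtopology by (auto intro: exI[of _ 1])
  then show "Rplus g \<subseteq> topspace (gtopology g)"
    by (rule openin_subset)
qed

definition gcont :: "(real \<Rightarrow> real) \<Rightarrow> rpoint set \<Rightarrow> (rpoint \<Rightarrow> real) set" where
  "gcont g X = {f. continuous_map (subtopology (gtopology g) X) euclideanreal f}"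

definition gintegral :: "(real \<Rightarrow> real) \<Rightarrow> real \<Rightarrow> real \<Rightarrow> (real \<Rightarrow> real) \<Rightarrow> real" where
  "gintegral g x y f =
     (if x \<le> y then LINT t:{x..<y}|stieltjes g. f t
      else - (LINT t:{y..<x}|stieltjes g. f t))"

primrec gmonomial :: "(real \<Rightarrow> real) \<Rightarrow> real \<Rightarrow> nat \<Rightarrow> real \<Rightarrow> real" where
  "gmonomial g x0 0 = (\<lambda>x. 1)"
| "gmonomial g x0 (Suc n) = (\<lambda>x. real (Suc n) * gintegral g x0 x (gmonomial g x0 n))"

definition g_polynomials :: "(real \<Rightarrow> real) \<Rightarrow> real \<Rightarrow> nat \<Rightarrow> (real \<Rightarrow> real) set" where
  "g_polynomials g x0 n = {p. \<exists>c. p = (\<lambda>x. \<Sum>k\<le>n. c k * gmonomial g x0 k x)}"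

definition sup_norm :: "rpoint set \<Rightarrow> (rpoint \<Rightarrow> real) \<Rightarrow> real" where
  "sup_norm X h = (SUP x\<in>X. \<bar>h x\<bar>)"

definition best_approximation ::
  "(real \<Rightarrow> real) \<Rightarrow> real \<Rightarrow> nat \<Rightarrow> rpoint set \<Rightarrow> (rpoint \<Rightarrow> real) \<Rightarrow> (real \<Rightarrow> real) \<Rightarrow> bool" where
  "best_approximation g x0 n X f p \<longleftrightarrow>
     sup_norm X (\<lambda>x. f x - extend p x) =
       (INF q\<in>g_polynomials g x0 n. sup_norm X (\<lambda>x. f x - extend q x))"

end

theory Submission
  imports Defs
begin

text \<open>
  Everything factors through \<open>g\<close>, so the problem is one of uniform approximation on the compact set
  \<open>g(X)\<close> of reals. There the monomials form a Chebyshev system in a strong sense: a combination of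
  degree at most \<open>m\<close> whose values at \<open>m + 2\<close> points weakly alternate in sign has zero coefficients.
  This follows from a Rolle argument, the increment of a combination being the integral of a
  combination of lower degree. Sufficiency of the alternation is then immediate. For necessity, if
  the residual has at most \<open>n\<close> sign changes on the set where it is extremal, a combination vanishing
  at the right endpoints of the blocks of constant sign has the sign of the residual elsewhere on
  this set; adding a small multiple of a combination that interpolates the residual at these
  endpoints makes the agreement strict, and a small step in this direction improves the
  approximation.
\<close>

section \<open>Best approximation by Chebyshev systems\<close>

text \<open>Two obstacles shape the argument. A combination of monomials may leap over zero at a
  jump of \<open>g\<close>, and \<open>g(X)\<close> may have gaps. So a change of sign need not
  produce a zero, and counting zeros alone does not control signs. This is why weak alternation is
  the notion carried throughout: a zero counts with whichever sign is convenient, and the weak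
  inequality survives the passage from a nonnegative integral to a point where the integrand is
  nonnegative. Gaps also explain the form of the improving direction. Between two blocks of constant
  sign there may be no point of \<open>g(X)\<close> at which to place a zero, so the zeros sit at
  extremal points themselves, and the sign lost there has to be restored by interpolation. The
  intermediate points in Rolle's argument are real numbers that may lie outside \<open>X\<close>.
  Alternation is therefore excluded on all of \<open>Rplus g\<close> and only afterwards transported
  to \<open>g(X)\<close>.\<close>

lemma underdetermined_homogeneous_system:
  fixes A :: "'i \<Rightarrow> nat \<Rightarrow> real"
  assumes "finite I" "card I \<le> N"
  shows "\<exists>c. (\<exists>k\<le>N. c k \<noteq> 0) \<and> (\<forall>i\<in>I. (\<Sum>k\<le>N. c k * A i k) = 0)"
  using assms
proof (induction N arbitrary: I A)
  case 0
  then show ?case by (auto intro!: exI[of _ "\<lambda>_. 1"])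
next
  case (Suc N)
  show ?case
  proof (cases "\<forall>i\<in>I. A i (Suc N) = 0")
    case True
    then show ?thesis
      by (intro exI[of _ "\<lambda>k. if k = Suc N then 1 else 0"]) auto
  next
    case False
    then obtain j where j: "j \<in> I" "A j (Suc N) \<noteq> 0" by auto
    \<comment> \<open>Gaussian elimination: row \<open>j\<close> serves as pivot to remove the
      unknown of index \<open>Suc N\<close> from the other rows. That unknown is afterwards chosen
      in \<open>d\<close> so that row \<open>j\<close> holds.\<close>
    define B where "B i k = A i k - A i (Suc N) / A j (Suc N) * A j k" for i k
    obtain c where c: "\<exists>k\<le>N. c k \<noteq> 0" "\<forall>i\<in>I - {j}. (\<Sum>k\<le>N. c k * B i k) = 0"
      using Suc.IH[of "I - {j}" B] Suc.prems j by (force simp: card_Diff_singleton)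
    define S where "S i = (\<Sum>k\<le>N. c k * A i k)" for i
    define d where "d k = (if k = Suc N then - S j / A j (Suc N) else c k)" for k
    have d: "(\<Sum>k\<le>Suc N. d k * A i k) = S i - S j / A j (Suc N) * A i (Suc N)" for i
      by (simp add: d_def S_def)
    have "(\<Sum>k\<le>Suc N. d k * A i k) = 0" if "i \<in> I" for i
    proof (cases "i = j")
      case False
      have "(\<Sum>k\<le>N. c k * B i k) = S i - A i (Suc N) / A j (Suc N) * S j"
        by (simp add: B_def S_def sum_subtractf sum_distrib_left algebra_simps)
      then show ?thesis using c(2) that False unfolding d by simp
    qed (use j in \<open>unfold d, simp\<close>)
    moreover obtain k where "k \<le> N" "c k \<noteq> 0" using c(1) by blast
    then have "k \<le> Suc N \<and> d k \<noteq> 0" by (auto simp: d_def)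
    ultimately show ?thesis by blast
  qed
qed

section \<open>Small perturbations on compact sets\<close>

lemma compact_level_set:
  fixes f :: "'a::t2_space \<Rightarrow> 'b::topological_space"
  assumes "compact K" "continuous_on K f" "closed T"
  shows "compact {x \<in> K. f x \<in> T}"
proof -
  have "closed (K \<inter> f -` T)"
    using assms by (intro continuous_closed_preimage compact_imp_closed)
  moreover have "{x \<in> K. f x \<in> T} = K \<inter> (K \<inter> f -` T)" by auto
  ultimately show ?thesis using assms(1) by (metis compact_Int_closed)
qed

text \<open>Only the points with \<open>v x \<le> 0\<close> can do harm. They form a compact set on
  which \<open>u\<close> has a positive minimum, while \<open>v\<close> is bounded. The conclusion
  covers every small \<open>e\<close>, so that further upper bounds may be imposed on the
  step.\<close>

lemma positive_perturbation:
  fixes u v :: "'a::t2_space \<Rightarrow> real"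
  assumes K: "compact K" and u: "continuous_on K u" and v: "continuous_on K v"
    and nonneg: "\<And>x. x \<in> K \<Longrightarrow> u x \<ge> 0" and pos: "\<And>x. x \<in> K \<Longrightarrow> u x = 0 \<Longrightarrow> v x > 0"
  shows "\<exists>\<delta>>0. \<forall>e. 0 < e \<and> e \<le> \<delta> \<longrightarrow> (\<forall>x\<in>K. u x + e * v x > 0)"
proof -
  define C where "C = {x \<in> K. v x \<le> 0}"
  show ?thesis
  proof (cases "C = {}")
    case True
    then have "v x > 0" if "x \<in> K" for x using that by (force simp: C_def)
    then show ?thesis using nonneg
      by (intro exI[of _ 1]) (auto intro!: add_nonneg_pos)
  next
    case False
    have "compact C" using compact_level_set[OF K v, of "{..0}"] by (simp add: C_def)
    moreover have "continuous_on C u" using u by (rule continuous_on_subset) (auto simp: C_def)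
    ultimately obtain y where y: "y \<in> C" "\<And>x. x \<in> C \<Longrightarrow> u y \<le> u x"
      using continuous_attains_inf[of C u] False by blast
    have uy: "u y > 0" using y(1) nonneg[of y] pos[of y] by (force simp: C_def)
    have "bounded (v ` K)" using compact_continuous_image[OF v K] by (rule compact_imp_bounded)
    then obtain M where M: "M > 0" "\<And>x. x \<in> K \<Longrightarrow> \<bar>v x\<bar> \<le> M"
      unfolding bounded_pos by auto
    \<comment> \<open>The denominator \<open>M + 1\<close> instead of \<open>M\<close> makes the
      loss \<open>e * M\<close> strictly smaller than the minimum \<open>u y\<close>.\<close>
    have "u x + e * v x > 0" if e: "0 < e" "e \<le> u y / (M + 1)" and x: "x \<in> K" for e x
    proof (cases "x \<in> C")
      case True
      have "e * (- v x) \<le> u y / (M + 1) * M"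
        using e M(2)[OF x] True uy M(1) by (intro mult_mono) (auto simp: C_def)
      also have "\<dots> < u y" using uy M(1) by (simp add: field_simps)
      finally show ?thesis using y(2)[OF True] by simp
    next
      case False
      then show ?thesis using x e nonneg[OF x] by (auto simp: C_def intro!: add_nonneg_pos)
    qed
    then show ?thesis using uy M(1) by (intro exI[of _ "u y / (M + 1)"]) auto
  qed
qed

lemma kolmogorov_improvement:
  fixes r q :: "'a::t2_space \<Rightarrow> real"
  assumes Y: "compact Y" and r: "continuous_on Y r" and q: "continuous_on Y q"
    and bound: "\<And>x. x \<in> Y \<Longrightarrow> \<bar>r x\<bar> \<le> E"
    and pos: "\<And>x. x \<in> Y \<Longrightarrow> \<bar>r x\<bar> = E \<Longrightarrow> r x * q x > 0"
  shows "\<exists>e>0. \<forall>x\<in>Y. \<bar>r x - e * q x\<bar> < E"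
proof (cases "Y = {}")
  case True
  then show ?thesis by (auto intro: exI[of _ 1])
next
  case False
  then have E: "E \<ge> 0" using bound abs_ge_zero order_trans by blast
  define K where "K = {x \<in> Y. \<bar>r x\<bar> = E}"
  have rq: "r x * q x > 0" if "x \<in> K" for x using that pos by (auto simp: K_def)
  have K: "compact K"
    using compact_level_set[OF Y continuous_on_rabs[OF r], of "{E}"] by (simp add: K_def)
  have sub: "K \<subseteq> Y" by (auto simp: K_def)
  have "\<exists>\<theta>>0. \<forall>e. 0 < e \<and> e \<le> \<theta> \<longrightarrow> (\<forall>x\<in>K. 2 * (r x * q x) + e * (- (q x)\<^sup>2) > 0)"
  proof (rule positive_perturbation[OF K])
    show "continuous_on K (\<lambda>x. 2 * (r x * q x))" "continuous_on K (\<lambda>x. - (q x)\<^sup>2)"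
      by (intro continuous_intros continuous_on_subset[OF r sub] continuous_on_subset[OF q sub])+
    show "2 * (r x * q x) \<ge> 0" if "x \<in> K" for x using rq[OF that] by linarith
    show "- (q x)\<^sup>2 > 0" if "x \<in> K" "2 * (r x * q x) = 0" for x
      using rq[OF that(1)] that(2) by linarith
  qed
  then obtain \<theta> where \<theta>: "\<theta> > 0" "\<And>x. x \<in> K \<Longrightarrow> 2 * (r x * q x) + \<theta> * (- (q x)\<^sup>2) > 0"
    by (meson order_refl)
  have sq: "(r x)\<^sup>2 \<le> E\<^sup>2" if "x \<in> Y" for x
    using bound[OF that] abs_ge_zero power_mono power2_abs by metis
  have eq: "\<bar>r x\<bar> = E" if "E\<^sup>2 - (r x)\<^sup>2 = 0" for x
    using that E by (auto simp: power2_eq_iff)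
  have "\<exists>\<delta>>0. \<forall>e. 0 < e \<and> e \<le> \<delta> \<longrightarrow>
      (\<forall>x\<in>Y. E\<^sup>2 - (r x)\<^sup>2 + e * (2 * (r x * q x) + \<theta> * (- (q x)\<^sup>2)) > 0)"
  proof (rule positive_perturbation[OF Y])
    show "continuous_on Y (\<lambda>x. E\<^sup>2 - (r x)\<^sup>2)"
      "continuous_on Y (\<lambda>x. 2 * (r x * q x) + \<theta> * (- (q x)\<^sup>2))"
      by (intro continuous_intros r q)+
    show "E\<^sup>2 - (r x)\<^sup>2 \<ge> 0" if "x \<in> Y" for x using sq[OF that] by linarith
    show "2 * (r x * q x) + \<theta> * (- (q x)\<^sup>2) > 0" if "x \<in> Y" "E\<^sup>2 - (r x)\<^sup>2 = 0" for x
      using \<theta>(2) eq[OF that(2)] that(1) unfolding K_def by blast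
  qed
  then obtain \<delta> where \<delta>: "\<delta> > 0" "\<And>e x. 0 < e \<Longrightarrow> e \<le> \<delta> \<Longrightarrow> x \<in> Y \<Longrightarrow>
      E\<^sup>2 - (r x)\<^sup>2 + e * (2 * (r x * q x) + \<theta> * (- (q x)\<^sup>2)) > 0"
    by metis
  define e where "e = min \<delta> \<theta>"
  have "\<bar>r x - e * q x\<bar> < E" if x: "x \<in> Y" for x
  proof -
    have "e * (e * (q x)\<^sup>2) \<le> e * (\<theta> * (q x)\<^sup>2)"
      using \<delta>(1) \<theta>(1) by (intro mult_left_mono mult_right_mono) (auto simp: e_def)
    moreover have "E\<^sup>2 - (r x)\<^sup>2 + e * (2 * (r x * q x) + \<theta> * (- (q x)\<^sup>2)) > 0"
      using \<delta> \<theta>(1) x by (auto simp: e_def)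
    ultimately have "(r x - e * q x)\<^sup>2 < E\<^sup>2"
      by (simp add: power2_eq_square algebra_simps)
    then show ?thesis using E power2_less_imp_less[of "\<bar>r x - e * q x\<bar>" E] by simp
  qed
  then show ?thesis using \<delta>(1) \<theta>(1) by (intro exI[of _ e]) (auto simp: e_def)
qed

text \<open>A set without long alternations of \<open>r\<close> splits into few blocks of constant sign; \<open>Z\<close> collects
  the right endpoints of all blocks but the last.\<close>

lemma sign_blocks:
  fixes r :: "real \<Rightarrow> real"
  assumes "compact K" "continuous_on K r" "\<And>x. x \<in> K \<Longrightarrow> \<bar>r x\<bar> = E" "E > 0"
    and "\<not> (\<exists>t. (\<forall>i\<le>Suc n. t i \<in> K) \<and> (\<forall>i\<le>n. t i < t (Suc i)) \<and> (\<forall>i\<le>n. r (t i) = - r (t (Suc i))))"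
  shows "\<exists>Z s. finite Z \<and> Z \<subseteq> K \<and> card Z \<le> n \<and> (\<forall>z\<in>Z. \<exists>x\<in>K. z < x) \<and>
    (\<forall>x\<in>K - Z. s * (-1) ^ card {z \<in> Z. z < x} * r x > 0)"
  using assms
proof (induction n arbitrary: K)
  case (0 K)
  have const: "r x = r y" if "x \<in> K" "y \<in> K" "x < y" for x y
  proof (rule ccontr)
    assume "r x \<noteq> r y"
    then have "r x = - r y" using 0(3)[OF that(1)] 0(3)[OF that(2)] by linarith
    then show False using 0(5) that by (auto dest!: spec[of _ "\<lambda>i. if i = 0 then x else y"] split: if_splits)
  qed
  then have const: "r x = r y" if "x \<in> K" "y \<in> K" for x y
    using that by (metis linorder_neqE)
  show ?case
  proof (cases "K = {}")
    case False
    then obtain y where y: "y \<in> K" by auto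
    have "r y * r x > 0" if "x \<in> K" for x
    proof -
      have "r x \<noteq> 0" using 0(3)[OF that] 0(4) by auto
      then show ?thesis using const[OF y that] by (metis not_real_square_gt_zero)
    qed
    then show ?thesis by (intro exI[of _ "{}"] exI[of _ "r y"]) auto
  qed auto
next
  case (Suc n K)
  show ?case
  proof (cases "\<forall>x\<in>K. \<forall>y\<in>K. r x = r y")
    case const: True
    show ?thesis
    proof (cases "K = {}")
      case False
      then obtain y where y: "y \<in> K" by auto
      have "r y * r x > 0" if "x \<in> K" for x
      proof -
        have "r x \<noteq> 0" using Suc.prems(3)[OF that] Suc.prems(4) by auto
        then show ?thesis using const y that by (metis not_real_square_gt_zero)
      qed
      then show ?thesis by (intro exI[of _ "{}"] exI[of _ "r y"]) auto
    qed (auto intro!: exI[of _ "{}"])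
  next
    case False
    then obtain u where u: "u \<in> K" "\<And>x. x \<in> K \<Longrightarrow> x \<le> u"
      using compact_attains_sup[OF Suc.prems(1)] by blast
    have pm: "r x = r u \<or> r x = - r u" if "x \<in> K" for x
      using Suc.prems(3)[OF that] Suc.prems(3)[OF u(1)] by linarith
    have ru: "r u \<noteq> - r u" using Suc.prems(3)[OF u(1)] Suc.prems(4) by auto
    \<comment> \<open>The last block has the sign of \<open>r u\<close>. The greatest point
      \<open>z\<close> of opposite sign is the right end of the block before it, and cutting at
      \<open>z\<close> removes exactly the last block.\<close>
    define W where "W = {x \<in> K. r x = - r u}"
    have "W \<noteq> {}" using False pm by (force simp: W_def)
    have "compact W"
      using compact_level_set[OF Suc.prems(1,2) closed_singleton, of "- r u"] unfolding W_def by auto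
    then obtain z where z: "z \<in> W" "\<And>x. x \<in> W \<Longrightarrow> x \<le> z"
      using compact_attains_sup[OF \<open>compact W\<close> \<open>W \<noteq> {}\<close>] by blast
    have zK: "z \<in> K" "r z = - r u" using z(1) by (auto simp: W_def)
    then have zu: "z < u" using u(2)[of z] ru by (metis order_le_less)
    define K' where "K' = K \<inter> {..z}"
    have K': "compact K'" "K' \<subseteq> K" "z \<in> K'"
      using Suc.prems(1) zK by (auto simp: K'_def compact_Int_closed)
    have no: "\<not> (\<exists>t. (\<forall>i\<le>Suc n. t i \<in> K') \<and> (\<forall>i\<le>n. t i < t (Suc i)) \<and> (\<forall>i\<le>n. r (t i) = - r (t (Suc i))))"
    proof
      assume "\<exists>t. (\<forall>i\<le>Suc n. t i \<in> K') \<and> (\<forall>i\<le>n. t i < t (Suc i)) \<and> (\<forall>i\<le>n. r (t i) = - r (t (Suc i)))"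
      then obtain t where t: "\<And>i. i \<le> Suc n \<Longrightarrow> t i \<in> K'" "\<And>i. i \<le> n \<Longrightarrow> t i < t (Suc i)"
        "\<And>i. i \<le> n \<Longrightarrow> r (t i) = - r (t (Suc i))" by blast
      have last: "t (Suc n) \<in> K" "t (Suc n) \<le> z" using t(1)[of "Suc n"] by (auto simp: K'_def)
      \<comment> \<open>An alternation in \<open>K'\<close> can be prolonged in \<open>K\<close>: if
        it ends with the value \<open>- r u\<close>, by \<open>u\<close>; otherwise it ends with
        \<open>r u = - r z\<close> strictly before \<open>z\<close>, and \<open>z\<close> itself
        prolongs it.\<close>
      obtain w where w: "w \<in> K" "t (Suc n) < w" "r (t (Suc n)) = - r w"
      proof (cases "r (t (Suc n)) = - r u")
        case True
        then show ?thesis using that[of u] u(1) zu last by auto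
      next
        case False
        then have "r (t (Suc n)) = - r z" using pm[OF last(1)] zK by auto
        moreover have "t (Suc n) \<noteq> z" using False zK by auto
        ultimately show ?thesis using that[of z] zK last by auto
      qed
      define t' where "t' = t(Suc (Suc n) := w)"
      have "\<forall>i\<le>Suc (Suc n). t' i \<in> K" using t(1) w(1) K'(2) by (auto simp: t'_def le_Suc_eq)
      moreover have "\<forall>i\<le>Suc n. t' i < t' (Suc i)" "\<forall>i\<le>Suc n. r (t' i) = - r (t' (Suc i))"
        using t(2,3) w(2,3) by (auto simp: t'_def le_Suc_eq)
      ultimately show False using Suc.prems(5) by blast
    qed
    have "\<exists>Z s. finite Z \<and> Z \<subseteq> K' \<and> card Z \<le> n \<and> (\<forall>z\<in>Z. \<exists>x\<in>K'. z < x) \<and>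
        (\<forall>x\<in>K' - Z. s * (-1) ^ card {z \<in> Z. z < x} * r x > 0)"
      by (rule Suc.IH[OF K'(1) continuous_on_subset[OF Suc.prems(2) K'(2)] _ Suc.prems(4) no])
        (use K'(2) Suc.prems(3) in blast)
    then obtain Z s where Z: "finite Z" "Z \<subseteq> K'" "card Z \<le> n" "\<forall>y\<in>Z. \<exists>x\<in>K'. y < x"
      "\<forall>x\<in>K' - Z. s * (-1) ^ card {y \<in> Z. y < x} * r x > 0"
      by (elim exE conjE) (rule that)
    \<comment> \<open>Here the clause that each point of \<open>Z\<close> has a larger point in the
      set pays off: it places all of \<open>Z\<close> strictly before \<open>z\<close>.\<close>
    have Zz: "y < z" if "y \<in> Z" for y using Z(4) that by (force simp: K'_def)
    have zZ: "z \<notin> Z" using Zz by blast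
    have "s * (-1) ^ card {y \<in> insert z Z. y < x} * r x > 0" if x: "x \<in> K - insert z Z" for x
    proof (cases "x < z")
      case True
      then have "{y \<in> insert z Z. y < x} = {y \<in> Z. y < x}" by auto
      then show ?thesis using bspec[OF Z(5), of x] x True by (auto simp: K'_def)
    next
      case False
      then have xz: "z < x" using x by auto
      then have "x \<notin> W" using z(2) by force
      then have rx: "r x = - r z" using pm[of x] x zK by (auto simp: W_def)
      \<comment> \<open>Passing from \<open>z\<close> to \<open>x\<close> in the last block raises
        the count by one and reverses the sign of \<open>r\<close>; the two changes cancel.\<close>
      have "{y \<in> insert z Z. y < x} = insert z Z" "{y \<in> Z. y < z} = Z" using xz Zz by force+
      then show ?thesis using bspec[OF Z(5), of z] K'(3) zZ Z(1) rx by simp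
    qed
    moreover have "\<forall>y\<in>insert z Z. \<exists>x\<in>K. y < x" using Z(4) K'(2) zu u(1) by blast
    ultimately show ?thesis using Z(1-3) K'(2) zK zZ
      by (intro exI[of _ "insert z Z"] exI[of _ s]) auto
  qed
qed


section \<open>Chebyshev systems on a compact set of reals\<close>

lemma card_less_sorted_nth:
  fixes xs :: "'a::linorder list"
  assumes "sorted_wrt (<) xs" "i < length xs"
  shows "card {u \<in> set xs. u < xs ! i} = i"
proof -
  have "{u \<in> set xs. u < xs ! i} = (!) xs ` {..<i}"
  proof (intro equalityI subsetI)
    fix u assume "u \<in> {u \<in> set xs. u < xs ! i}"
    then obtain j where j: "j < length xs" "u = xs ! j" "xs ! j < xs ! i"
      by (auto simp: in_set_conv_nth)
    then have "j < i"
      using sorted_wrt_nth_less[OF assms(1), of i j] assms(2) by (cases i j rule: linorder_cases) auto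
    then show "u \<in> (!) xs ` {..<i}" using j by blast
  next
    fix u assume "u \<in> (!) xs ` {..<i}"
    then show "u \<in> {u \<in> set xs. u < xs ! i}"
      using sorted_wrt_nth_less[OF assms(1)] assms(2) by auto
  qed
  moreover have "inj_on ((!) xs) {..<i}"
    using strict_sorted_iff[of xs] assms by (auto intro!: inj_on_nth)
  ultimately show ?thesis by (simp add: card_image)
qed

text \<open>All degrees \<open>m \<le> n\<close> are included because a set of fewer than
  \<open>n\<close> prescribed zeros is treated in the degree equal to its size. The weak
  inequalities cover surplus zeros and changes of sign without a zero at once.\<close>

locale chebyshev_system =
  fixes Y :: "real set" and U :: "nat \<Rightarrow> real \<Rightarrow> real" and n :: nat
  assumes compact_Y: "compact Y"
    and large_Y: "infinite Y \<or> card Y \<ge> n + 2"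
    and continuous_on_U: "k \<le> n \<Longrightarrow> continuous_on Y (U k)"
    and no_weak_alternation:
      "\<lbrakk>m \<le> n; \<And>i. i \<le> Suc m \<Longrightarrow> t i \<in> Y; \<And>i. i \<le> m \<Longrightarrow> t i < t (Suc i);
        \<And>i. i \<le> Suc m \<Longrightarrow> (-1) ^ i * (\<Sum>k\<le>m. c k * U k (t i)) \<ge> 0; k \<le> m\<rbrakk> \<Longrightarrow> c k = 0"
begin

definition comb :: "nat \<Rightarrow> (nat \<Rightarrow> real) \<Rightarrow> real \<Rightarrow> real" where
  "comb m c y = (\<Sum>k\<le>m. c k * U k y)"

lemma comb_add: "comb m (\<lambda>k. c k + d k) y = comb m c y + comb m d y"
  and comb_mult: "comb m (\<lambda>k. a * c k) y = a * comb m c y"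
  by (simp_all add: comb_def sum.distrib sum_distrib_left algebra_simps)

lemma comb_diff: "comb m (\<lambda>k. c k - d k) y = comb m c y - comb m d y"
  by (simp add: comb_def sum_subtractf algebra_simps)

lemma comb_minus: "comb m (\<lambda>k. - c k) y = - comb m c y"
  by (simp add: comb_def sum_negf)

lemma comb_pad: "m \<le> n' \<Longrightarrow> comb n' (\<lambda>k. if k \<le> m then c k else 0) y = comb m c y"
  unfolding comb_def by (rule sum.mono_neutral_cong_right) auto

lemma continuous_on_comb: "m \<le> n \<Longrightarrow> continuous_on Y (comb m c)"
  unfolding comb_def by (intro continuous_intros continuous_on_U) auto

lemma exists_outside:
  assumes "finite Z" "card Z \<le> n + 1"
  shows "\<exists>y\<in>Y. y \<notin> Z"
proof (rule ccontr)
  assume "\<not> ?thesis"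
  then have "Y \<subseteq> Z" by auto
  then have "finite Y" "card Y \<le> card Z" using assms(1) by (auto intro: finite_subset card_mono)
  then show False using large_Y assms(2) by auto
qed

text \<open>The exponent counts the smaller points of \<open>T\<close> instead of using an index, so
  that points can be inserted into a set without renumbering a sequence.\<close>

lemma no_weak_alternation_set:
  assumes m: "m \<le> n" and T: "finite T" "T \<subseteq> Y" "card T = m + 2"
    and alt: "\<And>t. t \<in> T \<Longrightarrow> (-1) ^ card {u \<in> T. u < t} * comb m c t \<ge> 0" and k: "k \<le> m"
  shows "c k = 0"
proof (rule no_weak_alternation[OF m _ _ _ k])
  define xs where "xs = sorted_list_of_set T"
  have xs: "sorted_wrt (<) xs" "length xs = m + 2" "set xs = T"
    using T by (simp_all add: xs_def)
  show mem: "xs ! i \<in> Y" if "i \<le> Suc m" for i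
    using that xs T(2) nth_mem[of i xs] by auto
  show "xs ! i < xs ! Suc i" if "i \<le> m" for i
    using that xs(2) sorted_wrt_nth_less[OF xs(1), of i "Suc i"] by auto
  show "(-1) ^ i * (\<Sum>k\<le>m. c k * U k (xs ! i)) \<ge> 0" if "i \<le> Suc m" for i
    using alt[of "xs ! i"] card_less_sorted_nth[OF xs(1), of i] that xs nth_mem[of i xs]
    by (auto simp: comb_def)
qed

text \<open>Zeros fit every sign pattern. After one further point of \<open>Y\<close> is added, its
  value is the only one with a sign to match, and replacing \<open>c\<close> by \<open>- c\<close>
  matches it.\<close>

lemma zeros_imp_coefficients_zero:
  assumes m: "m \<le> n" and Z: "finite Z" "Z \<subseteq> Y" "card Z = m + 1"
    and zero: "\<And>z. z \<in> Z \<Longrightarrow> comb m c z = 0" and k: "k \<le> m"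
  shows "c k = 0"
proof -
  obtain y where y: "y \<in> Y" "y \<notin> Z" using exists_outside[OF Z(1)] Z(3) m by auto
  define e :: real where "e = (-1) ^ card {u \<in> insert y Z. u < y} * comb m c y"
  have T: "finite (insert y Z)" "insert y Z \<subseteq> Y" "card (insert y Z) = m + 2"
    using y Z by auto
  show ?thesis
  proof (cases "e \<ge> 0")
    case True
    show ?thesis
      by (rule no_weak_alternation_set[OF m T _ k]) (use True zero in \<open>auto simp: e_def\<close>)
  next
    case False
    have "- c k = 0"
      by (rule no_weak_alternation_set[OF m T _ k])
        (use False zero in \<open>auto simp: e_def comb_minus\<close>)
    then show ?thesis by simp
  qed
qed

text \<open>When \<open>x\<close> and \<open>y\<close> join \<open>Z\<close>, the count below
  \<open>y\<close> grows by one, because of \<open>x\<close>, and the count below \<open>x\<close>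
  stays. A nonpositive product would thus make \<open>c\<close> or \<open>- c\<close> weakly
  alternating on \<open>m + 2\<close> points.\<close>

lemma sign_between_zeros:
  assumes m: "m \<le> n" and Z: "finite Z" "Z \<subseteq> Y" "card Z = m"
    and zero: "\<And>z. z \<in> Z \<Longrightarrow> comb m c z = 0" and c: "k \<le> m" "c k \<noteq> 0"
    and xy: "x \<in> Y - Z" "y \<in> Y - Z" "x < y"
  shows "((-1) ^ card {z \<in> Z. z < x} * comb m c x) * ((-1) ^ card {z \<in> Z. z < y} * comb m c y) > 0"
    (is "?A * ?B > 0")
proof (rule ccontr)
  assume neg: "\<not> ?A * ?B > 0"
  define T where "T = insert x (insert y Z)"
  have T: "finite T" "T \<subseteq> Y" "card T = m + 2" using Z xy by (auto simp: T_def)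
  have "{u \<in> T. u < x} = {z \<in> Z. z < x}" "{u \<in> T. u < y} = insert x {z \<in> Z. z < y}"
    using xy by (auto simp: T_def)
  then have card: "card {u \<in> T. u < x} = card {z \<in> Z. z < x}"
    "card {u \<in> T. u < y} = Suc (card {z \<in> Z. z < y})"
    using xy Z(1) by auto
  consider "?A \<ge> 0" "?B \<le> 0" | "?A \<le> 0" "?B \<ge> 0"
    using neg by (auto simp: not_less mult_le_0_iff)
  then show False
  proof cases
    case 1
    have "c k = 0"
      by (rule no_weak_alternation_set[OF m T _ c(1)])
        (use 1 zero card in \<open>auto simp: T_def\<close>)
    then show False using c(2) by simp
  next
    case 2
    have "- c k = 0"
      by (rule no_weak_alternation_set[OF m T _ c(1)])
        (use 2 zero card in \<open>auto simp: T_def comb_minus\<close>)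
    then show False using c(2) by simp
  qed
qed

lemma prescribed_sign_changes:
  assumes m: "m \<le> n" and Z: "finite Z" "Z \<subseteq> Y" "card Z = m"
  shows "\<exists>c. (\<forall>z\<in>Z. comb m c z = 0) \<and> (\<forall>x\<in>Y - Z. (-1) ^ card {z \<in> Z. z < x} * comb m c x > 0)"
proof -
  obtain c k where c: "k \<le> m" "c k \<noteq> 0" and "\<forall>z\<in>Z. (\<Sum>k\<le>m. c k * U k z) = 0"
    using underdetermined_homogeneous_system[of Z m "\<lambda>z k. U k z"] Z by auto
  then have zero: "\<And>z. z \<in> Z \<Longrightarrow> comb m c z = 0" by (simp add: comb_def)
  obtain y where y: "y \<in> Y - Z" using exists_outside[OF Z(1)] Z(3) m by auto
  \<comment> \<open>\<open>A\<close> is the value corrected by the expected sign. It has one sign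
    off \<open>Z\<close>, and its value at the reference point \<open>y\<close>, nonzero since
    \<open>c\<close> would otherwise have \<open>m + 1\<close> zeros, turns that sign into
    plus.\<close>
  define A where "A x = (-1) ^ card {z \<in> Z. z < x} * comb m c x" for x
  have Ay: "A y \<noteq> 0"
  proof
    assume "A y = 0"
    then have "comb m c z = 0" if "z \<in> insert y Z" for z using that zero by (auto simp: A_def)
    then have "c k = 0" using zeros_imp_coefficients_zero[OF m, of "insert y Z" c k] y Z c by auto
    then show False using c by simp
  qed
  have pos: "A x * A y > 0" if "x \<in> Y - Z" "y \<in> Y - Z" "x < y" for x y
    unfolding A_def by (rule sign_between_zeros[OF m Z zero c that])
  have "A y * A x > 0" if x: "x \<in> Y - Z" for x
  proof (cases x y rule: linorder_cases)
    case less
    then show ?thesis using pos[OF x y] by (simp add: mult.commute)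
  next
    case equal
    then show ?thesis using Ay by (metis not_real_square_gt_zero)
  next
    case greater
    then show ?thesis using pos[OF y x] by simp
  qed
  moreover have "(-1) ^ card {z \<in> Z. z < x} * comb m (\<lambda>k. A y * c k) x = A y * A x" for x
    unfolding comb_mult A_def[of x] by (rule mult.left_commute)
  ultimately have "\<forall>x\<in>Y - Z. (-1) ^ card {z \<in> Z. z < x} * comb m (\<lambda>k. A y * c k) x > 0"
    by simp
  moreover have "\<forall>z\<in>Z. comb m (\<lambda>k. A y * c k) z = 0" unfolding comb_mult using zero by simp
  ultimately show ?thesis by blast
qed

lemma interpolation:
  assumes m: "m \<le> n" and Z: "finite Z" "Z \<subseteq> Y" "card Z = m + 1"
  shows "\<exists>c. \<forall>z\<in>Z. comb m c z = v z"
proof -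
  \<comment> \<open>The data \<open>v\<close> enter as an additional column, which makes the system
    homogeneous with one unknown more than equations. Uniqueness forbids a zero coefficient of
    \<open>v\<close>, so one can divide by it.\<close>
  define A where "A z k = (if k = Suc m then v z else U k z)" for z k
  obtain c where c: "\<exists>k\<le>Suc m. c k \<noteq> 0" "\<And>z. z \<in> Z \<Longrightarrow> (\<Sum>k\<le>Suc m. c k * A z k) = 0"
    using underdetermined_homogeneous_system[of Z "Suc m" A] Z by auto
  have eq: "comb m c z + c (Suc m) * v z = 0" if "z \<in> Z" for z
    using c(2)[OF that] by (simp add: A_def comb_def)
  have "c (Suc m) \<noteq> 0"
  proof
    assume 0: "c (Suc m) = 0"
    then have "c k = 0" if "k \<le> m" for k
      using zeros_imp_coefficients_zero[OF m Z, of c k] eq that by auto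
    then show False using c(1) 0 by (auto simp: le_Suc_eq)
  qed
  then have "comb m (\<lambda>k. - (1 / c (Suc m)) * c k) z = v z" if "z \<in> Z" for z
    using eq[OF that] unfolding comb_mult by (simp add: field_simps)
  then show ?thesis by blast
qed

lemma same_sign_on_blocks:
  assumes K: "compact K" "K \<subseteq> Y" and r: "continuous_on K r" "\<And>x. x \<in> K \<Longrightarrow> r x \<noteq> 0"
    and Z: "finite Z" "Z \<subseteq> K" "card Z \<le> n"
    and blocks: "\<And>x. x \<in> K - Z \<Longrightarrow> s * (-1) ^ card {z \<in> Z. z < x} * r x > 0"
  shows "\<exists>c. \<forall>x\<in>K. r x * comb n c x > 0"
proof -
  have ZY: "Z \<subseteq> Y" using Z(2) K(2) by (rule order_trans)
  obtain q where q: "\<forall>z\<in>Z. comb (card Z) q z = 0"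
    "\<forall>x\<in>Y - Z. (-1) ^ card {z \<in> Z. z < x} * comb (card Z) q x > 0"
    using prescribed_sign_changes[OF Z(3,1) ZY refl] by (elim exE conjE) (rule that)
  define q' where "q' k = s * (if k \<le> card Z then q k else 0)" for k
  have q': "comb n q' x = s * comb (card Z) q x" for x
    unfolding q'_def comb_mult using Z(3) by (simp add: comb_pad)
  \<comment> \<open>Interpolation at \<open>card Z\<close> points takes degree
    \<open>card Z - 1\<close>; with no points there is nothing to match, hence the case
    distinction.\<close>
  obtain h where h: "\<forall>z\<in>Z. comb n h z = r z"
  proof (cases "card Z")
    case 0
    then show ?thesis using that Z(1) by auto
  next
    case (Suc m)
    then have m: "m \<le> n" using Z(3) by simp
    obtain h where "\<forall>z\<in>Z. comb m h z = r z"
      using interpolation[OF m, of Z r] Suc Z K(2) by auto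
    then show ?thesis
      using that[of "\<lambda>k. if k \<le> m then h k else 0"] comb_pad[OF m] by auto
  qed
  have cont: "continuous_on K (\<lambda>x. r x * comb n c x)" for c
    by (intro continuous_intros r continuous_on_subset[OF continuous_on_comb K(2)]) simp
  have pos: "r x * comb n q' x > 0" if x: "x \<in> K - Z" for x
  proof -
    have "(-1) ^ card {z \<in> Z. z < x} * comb (card Z) q x > 0" using q(2) x K(2) by auto
    then have "((-1) ^ card {z \<in> Z. z < x} * comb (card Z) q x) * (s * (-1) ^ card {z \<in> Z. z < x} * r x) > 0"
      using blocks[OF x] by (rule mult_pos_pos)
    also have "\<dots> = ((-1) ^ card {z \<in> Z. z < x})\<^sup>2 * (r x * comb n q' x)"
      by (simp add: q' power2_eq_square mult_ac)
    finally show ?thesis by (simp flip: power_mult)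
  qed
  \<comment> \<open>On \<open>K\<close>, the product \<open>r x * comb n q' x\<close> can vanish
    only on \<open>Z\<close>, and there \<open>r x * comb n h x\<close> is the square of
    \<open>r x\<close>.\<close>
  have "\<exists>\<delta>>0. \<forall>e. 0 < e \<and> e \<le> \<delta> \<longrightarrow> (\<forall>x\<in>K. r x * comb n q' x + e * (r x * comb n h x) > 0)"
  proof (rule positive_perturbation[OF K(1) cont cont])
    fix x assume x: "x \<in> K"
    show "r x * comb n q' x \<ge> 0"
      using pos[of x] x q(1) by (cases "x \<in> Z") (auto simp: q')
    show "r x * comb n h x > 0" if "r x * comb n q' x = 0"
    proof -
      have "x \<in> Z" using pos[of x] x that by auto
      then have "r x * comb n h x = (r x)\<^sup>2" using h by (simp add: power2_eq_square)
      then show ?thesis using r(2)[OF x] by simp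
    qed
  qed
  then obtain \<delta> where "\<forall>x\<in>K. r x * comb n q' x + \<delta> * (r x * comb n h x) > 0" by blast
  then have "\<forall>x\<in>K. r x * comb n (\<lambda>k. q' k + \<delta> * h k) x > 0"
    by (simp add: comb_add comb_mult algebra_simps)
  then show ?thesis by blast
qed

lemma abs_le_err:
  assumes F: "continuous_on Y F" and y: "y \<in> Y"
  shows "\<bar>F y - comb n d y\<bar> \<le> (SUP y\<in>Y. \<bar>F y - comb n d y\<bar>)"
proof (rule cSUP_upper[OF y])
  show "bdd_above ((\<lambda>y. \<bar>F y - comb n d y\<bar>) ` Y)"
    by (intro bounded_imp_bdd_above compact_imp_bounded compact_continuous_image continuous_intros
        F continuous_on_comb compact_Y order_refl)
qed

theorem alternation_theorem:
  assumes F: "continuous_on Y F"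
  defines "err \<equiv> \<lambda>c. SUP y\<in>Y. \<bar>F y - comb n c y\<bar>"
  shows "(\<forall>d. err c \<le> err d) \<longleftrightarrow>
    (\<exists>t. (\<forall>i\<le>Suc n. t i \<in> Y) \<and> (\<forall>i\<le>n. t i < t (Suc i)) \<and>
      (\<forall>i\<le>Suc n. \<bar>F (t i) - comb n c (t i)\<bar> = err c) \<and>
      (\<forall>i\<le>n. F (t i) - comb n c (t i) = - (F (t (Suc i)) - comb n c (t (Suc i)))))"
    (is "?best \<longleftrightarrow> ?alt")
proof
  define r where "r d y = F y - comb n d y" for d y
  have cont: "continuous_on Y (r d)" for d
    unfolding r_def by (intro continuous_intros F continuous_on_comb) simp
  have le_err: "\<bar>r d y\<bar> \<le> err d" if "y \<in> Y" for d y
    unfolding err_def r_def by (rule abs_le_err[OF F that])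
  obtain y0 where y0: "y0 \<in> Y" using exists_outside[of "{}"] by auto
  have attained: "\<exists>y\<in>Y. err d = \<bar>r d y\<bar>" for d
  proof -
    obtain y where y: "y \<in> Y" "\<And>x. x \<in> Y \<Longrightarrow> \<bar>r d x\<bar> \<le> \<bar>r d y\<bar>"
      using continuous_attains_sup[OF compact_Y, of "\<lambda>y. \<bar>r d y\<bar>"] y0 continuous_on_rabs[OF cont] by auto
    then have "err d \<le> \<bar>r d y\<bar>"
      unfolding err_def r_def[symmetric] using y0 by (intro cSUP_least) auto
    then show ?thesis using le_err[OF y(1), of d] y(1) by force
  qed
  {
    assume ?alt
    then obtain t where t: "\<And>i. i \<le> Suc n \<Longrightarrow> t i \<in> Y" "\<And>i. i \<le> n \<Longrightarrow> t i < t (Suc i)"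
      "\<And>i. i \<le> Suc n \<Longrightarrow> \<bar>r c (t i)\<bar> = err c" "\<And>i. i \<le> n \<Longrightarrow> r c (t i) = - r c (t (Suc i))"
      unfolding r_def by blast
    show ?best
    proof (rule ccontr)
      assume "\<not> ?best"
      then obtain d where d: "err d < err c" by (auto simp: not_le)
      have rt: "r c (t i) = (-1) ^ i * r c (t 0)" if "i \<le> Suc n" for i
        using that by (induction i) (use t(4) in force)+
      \<comment> \<open>The sign \<open>s\<close> lets the alternation start with plus, as the
        hypothesis of the locale demands.\<close>
      define s where "s = sgn (r c (t 0))"
      have "s * (d k - c k) = 0" if k: "k \<le> n" for k
      proof (rule no_weak_alternation[where t = t and m = n])
        show "n \<le> n" "k \<le> n" using k by simp_all
        show "t i \<in> Y" if "i \<le> Suc n" for i using t(1) that .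
        show "t i < t (Suc i)" if "i \<le> n" for i using t(2) that .
        fix i assume i: "i \<le> Suc n"
        have "\<bar>r d (t i)\<bar> \<le> err c" using le_err[OF t(1)[OF i], of d] d by simp
        \<comment> \<open>Where \<open>r c\<close> attains \<open>err c\<close> in absolute value,
          the smaller \<open>r d\<close> cannot reverse its sign by subtraction.\<close>
        then have "r c (t i) * (r c (t i) - r d (t i)) \<ge> 0"
          using t(3)[OF i] by (auto simp: zero_le_mult_iff abs_le_iff)
        also have "r c (t i) - r d (t i) = comb n (\<lambda>k. d k - c k) (t i)"
          by (simp add: r_def comb_diff)
        finally have "\<bar>r c (t 0)\<bar> * ((-1) ^ i * comb n (\<lambda>k. s * (d k - c k)) (t i)) \<ge> 0"
          unfolding rt[OF i] comb_mult s_def by (simp add: mult_ac abs_mult_sgn flip: mult.assoc)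
        moreover have "r c (t 0) = 0 \<Longrightarrow> s = 0" by (simp add: s_def)
        ultimately show "(-1) ^ i * (\<Sum>k\<le>n. s * (d k - c k) * U k (t i)) \<ge> 0"
          by (cases "r c (t 0) = 0") (auto simp: comb_def[symmetric] zero_le_mult_iff)
      qed
      moreover have "err d \<ge> 0" using attained[of d] by auto
      then have "s \<noteq> 0" using t(3)[of 0] d by (auto simp: s_def sgn_eq_0_iff)
      ultimately have "\<forall>k\<le>n. d k = c k" by auto
      then have "err d = err c" by (simp add: err_def comb_def)
      then show False using d by simp
    qed
  next
    assume best: ?best
    define E where "E = err c"
    define K where "K = {y \<in> Y. \<bar>r c y\<bar> = E}"
    have E: "E \<ge> 0" using attained[of c] by (auto simp: E_def)
    have "\<exists>t. (\<forall>i\<le>Suc n. t i \<in> K) \<and> (\<forall>i\<le>n. t i < t (Suc i)) \<and> (\<forall>i\<le>n. r c (t i) = - r c (t (Suc i)))"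
    proof (cases "E = 0")
      case True
      \<comment> \<open>A residual that vanishes on \<open>Y\<close> alternates on any points, so
        \<open>n + 2\<close> arbitrary points suffice.\<close>
      obtain T where T: "T \<subseteq> Y" "finite T" "card T = n + 2"
        using large_Y by (metis infinite_arbitrarily_large obtain_subset_with_card_n)
      have r0: "r c y = 0" if "y \<in> Y" for y using le_err[OF that, of c] True by (simp add: E_def)
      define xs where "xs = sorted_list_of_set T"
      have xs: "sorted_wrt (<) xs" "length xs = n + 2" "set xs = T"
        using T by (simp_all add: xs_def)
      have "xs ! i \<in> Y" if "i \<le> Suc n" for i
        using that xs T(1) nth_mem[of i xs] by auto
      moreover have "xs ! i < xs ! Suc i" if "i \<le> n" for i
        using that xs(2) sorted_wrt_nth_less[OF xs(1), of i "Suc i"] by auto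
      ultimately show ?thesis
        using True r0 by (intro exI[of _ "(!) xs"]) (simp add: K_def)
    next
      case False
      then have E: "E > 0" using E by simp
      have K: "compact K" "K \<subseteq> Y"
        using compact_level_set[OF compact_Y continuous_on_rabs[OF cont], of "{E}" c] by (auto simp: K_def)
      show ?thesis
      proof (rule ccontr)
        assume no: "\<not> ?thesis"
        have rK: "\<bar>r c x\<bar> = E" if "x \<in> K" for x using that by (simp add: K_def)
        obtain Z s where Z: "finite Z" "Z \<subseteq> K" "card Z \<le> n" and
          blocks: "\<forall>x\<in>K - Z. s * (-1) ^ card {z \<in> Z. z < x} * r c x > 0"
          using sign_blocks[OF K(1) continuous_on_subset[OF cont K(2)] rK E no] by auto
        have nonzero: "r c x \<noteq> 0" if "x \<in> K" for x using rK[OF that] E by auto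
        obtain q where q: "\<forall>x\<in>K. r c x * comb n q x > 0"
          using same_sign_on_blocks[OF K continuous_on_subset[OF cont K(2)] nonzero Z bspec[OF blocks]]
          by blast
        have "\<exists>e>0. \<forall>x\<in>Y. \<bar>r c x - e * comb n q x\<bar> < E"
          by (rule kolmogorov_improvement[OF compact_Y cont continuous_on_comb[OF order_refl]])
            (use le_err[of _ c] q in \<open>auto simp: K_def E_def\<close>)
        then obtain e where e: "\<forall>x\<in>Y. \<bar>r c x - e * comb n q x\<bar> < E" by blast
        define d where "d = (\<lambda>k. c k + e * q k)"
        have "r d x = r c x - e * comb n q x" for x
          by (simp add: r_def d_def comb_add comb_mult)
        then have "err d < E" using attained[of d] e by auto
        then show False using best by (auto simp: E_def not_le[symmetric])
      qed
    qed
    then obtain t where "\<forall>i\<le>Suc n. t i \<in> K" "\<forall>i\<le>n. t i < t (Suc i)"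
      "\<forall>i\<le>n. r c (t i) = - r c (t (Suc i))" by blast
    then show ?alt by (intro exI[of _ t]) (auto simp: K_def E_def r_def)
  }
qed

end

section \<open>Values and primitives on the extended line\<close>

text \<open>A class of integrands that is closed under \<open>gintegral\<close> and integrable on
  bounded Borel sets, so that the recursion for the monomials never leaves it.\<close>

definition locally_bounded_borel :: "(real \<Rightarrow> real) \<Rightarrow> bool" where
  "locally_bounded_borel m \<longleftrightarrow> m \<in> borel_measurable borel \<and> (\<forall>a b. \<exists>C. \<forall>x\<in>{a..b}. \<bar>m x\<bar> \<le> C)"

primrec base :: "rpoint \<Rightarrow> real" where
  "base (Pt t) = t"
| "base (PtR t) = t"

text \<open>The value of a primitive at \<open>x\<close> is its value far to the left plus the integral over
  \<open>lower x\<close>; in particular \<open>t\<^sup>+\<close> lies just after \<open>t\<close>.\<close>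

primrec lower :: "rpoint \<Rightarrow> real set" where
  "lower (Pt t) = {..<t}"
| "lower (PtR t) = {..t}"

lemma lower_total: "lower x \<subseteq> lower y \<or> lower y \<subseteq> lower x"
  by (cases x; cases y) auto

lemma lower_Pt_subset: "s \<in> lower y \<Longrightarrow> lower (Pt s) \<subseteq> lower y"
  by (cases y) auto

lemma lower_subset_Pt: "s \<notin> lower x \<Longrightarrow> lower x \<subseteq> lower (Pt s)"
  by (cases x) auto

lemma borel_lower [measurable]: "lower x \<in> sets borel"
  by (cases x) auto

text \<open>The \<open>+ 1\<close> leaves room for the point \<open>t\<close> that belongs to
  \<open>lower (PtR t)\<close>.\<close>

lemma lower_diff_bounded: "lower y - lower x \<subseteq> {base x..<base y + 1}"
  by (cases x; cases y) auto

lemma right_limit_eq: "(h \<longlongrightarrow> l) (at_right t) \<Longrightarrow> right_limit h t = l"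
  unfolding right_limit_def by (rule tendsto_Lim) simp

text \<open>\<open>right_limit\<close> is a \<open>Lim\<close>, which is meaningful only where the
  limit exists; linearity of \<open>extend\<close> rests on this.\<close>

definition has_right_limits :: "(real \<Rightarrow> real) \<Rightarrow> bool" where
  "has_right_limits h \<longleftrightarrow> (\<forall>t. \<exists>l. (h \<longlongrightarrow> l) (at_right t))"

lemma tendsto_right_limit:
  assumes "has_right_limits h"
  shows "(h \<longlongrightarrow> right_limit h t) (at_right t)"
proof -
  obtain l where "(h \<longlongrightarrow> l) (at_right t)" using assms by (auto simp: has_right_limits_def)
  then show ?thesis using right_limit_eq by metis
qed

lemma has_right_limits_cmult: "has_right_limits h \<Longrightarrow> has_right_limits (\<lambda>x. c * h x)"
  unfolding has_right_limits_def using tendsto_mult_left by blast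

lemma extend_cmult:
  assumes "has_right_limits h"
  shows "extend (\<lambda>x. c * h x) y = c * extend h y"
  by (cases y) (auto intro!: right_limit_eq tendsto_mult_left tendsto_right_limit assms)

lemma extend_sum:
  assumes "\<And>k. k \<in> I \<Longrightarrow> has_right_limits (h k)"
  shows "extend (\<lambda>x. \<Sum>k\<in>I. h k x) y = (\<Sum>k\<in>I. extend (h k) y)"
  by (cases y) (auto intro!: right_limit_eq tendsto_sum tendsto_right_limit assms)

lemma extend_const [simp]: "extend (\<lambda>x. c) y = c"
  by (cases y) (auto intro!: right_limit_eq)

lemma locally_bounded_borel_const: "locally_bounded_borel (\<lambda>_. c)"
  by (auto simp: locally_bounded_borel_def)

section \<open>Stieltjes integrals and their primitives\<close>

lemma set_integrable_locally_bounded: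
  assumes g: "derivator g" and m: "locally_bounded_borel m"
    and A: "A \<in> sets borel" "A \<subseteq> {a..<b}"
  shows "set_integrable (stieltjes g) A m"
    and "emeasure (stieltjes g) A < \<infinity>"
proof -
  have "emeasure (stieltjes g) A \<le> emeasure (stieltjes g) {a..<b}"
    using A by (intro emeasure_mono) auto
  also have "\<dots> < \<infinity>"
    using emeasure_stieltjes[OF g, of a b] by (cases "a \<le> b") auto
  finally show fin: "emeasure (stieltjes g) A < \<infinity>" .
  have meas: "m \<in> borel_measurable borel" using m by (simp add: locally_bounded_borel_def)
  obtain C where C: "\<And>x. x \<in> {a..b} \<Longrightarrow> \<bar>m x\<bar> \<le> C"
    using m unfolding locally_bounded_borel_def by blast
  show "set_integrable (stieltjes g) A m"
    unfolding set_integrable_def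
  proof (rule integrableI_bounded_set[OF _ _ fin])
    show "A \<in> sets (stieltjes g)" using A by simp
    have "m \<in> borel_measurable (stieltjes g)" using meas by (simp add: measurable_def)
    then show "(\<lambda>x. indicat_real A x *\<^sub>R m x) \<in> borel_measurable (stieltjes g)"
      using A by (intro borel_measurable_scaleR borel_measurable_indicator) auto
    show "AE x in stieltjes g. x \<in> A \<longrightarrow> norm (indicat_real A x *\<^sub>R m x) \<le> C"
      using A C by (intro AE_I2) force
  qed auto
qed

lemma abs_set_integral_le:
  assumes g: "derivator g" and m: "locally_bounded_borel m"
    and A: "A \<in> sets borel" "A \<subseteq> {a..<b}" and C: "\<And>s. s \<in> A \<Longrightarrow> \<bar>m s\<bar> \<le> C"
  shows "\<bar>LINT s:A|stieltjes g. m s\<bar> \<le> C * measure (stieltjes g) A"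
proof -
  note int = set_integrable_locally_bounded[OF g _ A]
  note c = locally_bounded_borel_const
  have const: "(LINT s:A|stieltjes g. c) = c * measure (stieltjes g) A" for c
    using set_integral_const[of A "stieltjes g" c] int(2)[OF m] A(1) by auto
  have "(LINT s:A|stieltjes g. m s) \<le> (LINT s:A|stieltjes g. C)"
    using C by (intro set_integral_mono int(1) m c) (auto simp: abs_le_iff)
  moreover have "(LINT s:A|stieltjes g. - C) \<le> (LINT s:A|stieltjes g. m s)"
    using C by (intro set_integral_mono int(1) m c) (force simp: abs_le_iff)
  ultimately show ?thesis unfolding const by (simp add: abs_le_iff)
qed

lemma set_integral_Ico_split:
  assumes g: "derivator g" and m: "locally_bounded_borel m" and "a \<le> b" "b \<le> c"
  shows "(LINT s:{a..<c}|stieltjes g. m s) =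
    (LINT s:{a..<b}|stieltjes g. m s) + (LINT s:{b..<c}|stieltjes g. m s)"
proof -
  have eq: "{a..<c} = {a..<b} \<union> {b..<c}" using assms by auto
  show ?thesis unfolding eq
    by (intro set_integral_Un set_integrable_locally_bounded(1)[OF g m _ order_refl]) auto
qed

lemma gintegral_diff:
  assumes "derivator g" "locally_bounded_borel m" "x \<le> y"
  shows "gintegral g x0 y m - gintegral g x0 x m = (LINT s:{x..<y}|stieltjes g. m s)"
proof -
  note split = set_integral_Ico_split[OF assms(1,2)]
  consider "x0 \<le> x" | "x < x0" "x0 \<le> y" | "y < x0" by linarith
  then show ?thesis
  proof cases
    case 1
    then show ?thesis using split[of x0 x y] assms(3) by (simp add: gintegral_def)
  next
    case 2
    then show ?thesis using split[of x x0 y] by (simp add: gintegral_def)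
  next
    case 3
    then show ?thesis using split[of x y x0] assms(3) by (simp add: gintegral_def)
  qed
qed

text \<open>Intervals \<open>{a..<S n}\<close> with \<open>S n\<close> decreasing to
  \<open>b\<close> shrink to the closed interval \<open>{a..b}\<close>, so the limit picks up the
  mass at \<open>b\<close>.\<close>

lemma tendsto_gintegral_right:
  assumes g: "derivator g" and m: "locally_bounded_borel m" and ab: "a \<le> b"
  shows "((\<lambda>x. gintegral g x0 x m) \<longlongrightarrow> gintegral g x0 a m + (LINT s:{a..b}|stieltjes g. m s)) (at_right b)"
proof (rule tendsto_at_right_sequentially[of b "b + 1"])
  fix S :: "nat \<Rightarrow> real"
  assume S: "\<And>n. b < S n" "decseq S" "S \<longlonglongrightarrow> b"
  have "(\<Inter>n. {a..<S n}) = {a..b}"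
  proof (intro equalityI subsetI)
    fix x assume "x \<in> (\<Inter>n. {a..<S n})"
    then have "a \<le> x" "\<And>n. x \<le> S n" by (auto intro: less_imp_le)
    then show "x \<in> {a..b}" using LIMSEQ_le_const[OF S(3)] by auto
  next
    fix x assume "x \<in> {a..b}"
    then show "x \<in> (\<Inter>n. {a..<S n})" using S(1) by (auto intro: le_less_trans)
  qed
  moreover have "(\<lambda>n. LINT s:{a..<S n}|stieltjes g. m s) \<longlonglongrightarrow> (LINT s:(\<Inter>n. {a..<S n})|stieltjes g. m s)"
  proof (rule set_integral_cont_down)
    show "decseq (\<lambda>n. {a..<S n})" using S(2) by (force simp: decseq_def)
    show "set_integrable (stieltjes g) {a..<S 0} m"
      by (rule set_integrable_locally_bounded(1)[OF g m _ order_refl]) simp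
  qed simp
  ultimately have "(\<lambda>n. gintegral g x0 a m + (LINT s:{a..<S n}|stieltjes g. m s)) \<longlonglongrightarrow>
      gintegral g x0 a m + (LINT s:{a..b}|stieltjes g. m s)"
    by (intro tendsto_add tendsto_const) simp
  moreover have "gintegral g x0 a m + (LINT s:{a..<S n}|stieltjes g. m s) = gintegral g x0 (S n) m" for n
    using gintegral_diff[OF g m, of a "S n" x0] S(1)[of n] ab by simp
  ultimately show "(\<lambda>n. gintegral g x0 (S n) m) \<longlonglongrightarrow> gintegral g x0 a m + (LINT s:{a..b}|stieltjes g. m s)"
    by simp
qed simp

lemma has_right_limits_gintegral:
  "derivator g \<Longrightarrow> locally_bounded_borel m \<Longrightarrow> has_right_limits (\<lambda>x. gintegral g x0 x m)"
  unfolding has_right_limits_def using tendsto_gintegral_right order_refl by blast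

lemma extend_gintegral:
  assumes "derivator g" "locally_bounded_borel m" "a \<le> base x"
  shows "extend (\<lambda>x. gintegral g x0 x m) x =
    gintegral g x0 a m + (LINT s:(lower x \<inter> {a..})|stieltjes g. m s)"
proof (cases x)
  case (Pt t)
  moreover have "{..<t} \<inter> {a..} = {a..<t}" by auto
  ultimately show ?thesis using gintegral_diff[OF assms(1,2), of a t x0] assms(3) by simp
next
  case (PtR t)
  moreover have "{..t} \<inter> {a..} = {a..t}" by auto
  ultimately show ?thesis
    using right_limit_eq[OF tendsto_gintegral_right[OF assms(1,2), of a t x0]] assms(3) by simp
qed

lemma extend_gintegral_diff:
  assumes g: "derivator g" and m: "locally_bounded_borel m" and xy: "lower x \<subseteq> lower y"
  shows "extend (\<lambda>x. gintegral g x0 x m) y - extend (\<lambda>x. gintegral g x0 x m) x =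
    (LINT s:(lower y - lower x)|stieltjes g. m s)"
proof -
  \<comment> \<open>Both sets \<open>lower x\<close> and \<open>lower y\<close> are unbounded;
    cutting them at a common \<open>a\<close> makes the integrals finite and leaves the difference
    unchanged.\<close>
  define a where "a = min (base x) (base y)"
  have bounded: "lower y - lower x \<subseteq> {a..<base y + 1}" "lower x \<inter> {a..} \<subseteq> {a..<base x + 1}"
    using lower_diff_bounded[of y x] by (force simp: a_def, cases x, auto)
  then have "lower y \<inter> {a..} = (lower x \<inter> {a..}) \<union> (lower y - lower x)"
    using xy by auto
  moreover have "set_integrable (stieltjes g) (lower x \<inter> {a..}) m"
    by (rule set_integrable_locally_bounded(1)[OF g m _ bounded(2)]) measurable
  moreover have "set_integrable (stieltjes g) (lower y - lower x) m"
    by (rule set_integrable_locally_bounded(1)[OF g m _ bounded(1)]) measurable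
  ultimately have "(LINT s:(lower y \<inter> {a..})|stieltjes g. m s) =
      (LINT s:(lower x \<inter> {a..})|stieltjes g. m s) + (LINT s:(lower y - lower x)|stieltjes g. m s)"
    using set_integral_Un[of "lower x \<inter> {a..}" "lower y - lower x" "stieltjes g" m] by auto
  then show ?thesis
    using extend_gintegral[OF g m, of a x x0] extend_gintegral[OF g m, of a y x0] by (simp add: a_def)
qed

section \<open>The extended derivator and its null level sets\<close>

lemma set_integral_one:
  assumes "derivator g" "A \<in> sets borel" "A \<subseteq> {a..<b}"
  shows "(LINT s:A|stieltjes g. 1) = measure (stieltjes g) A"
  using set_integral_const[of A "stieltjes g" "1::real"] assms
    set_integrable_locally_bounded(2)[OF assms(1) locally_bounded_borel_const assms(2,3)] by auto

lemma measure_Ico_stieltjes: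
  assumes "derivator g" "a \<le> b"
  shows "measure (stieltjes g) {a..<b} = g b - g a"
  using emeasure_stieltjes[OF assms] assms by (auto simp: measure_def derivator_def mono_def)

lemma gintegral_one:
  assumes "derivator g"
  shows "gintegral g x0 x (\<lambda>_. 1) = g x - g x0"
proof -
  have "(LINT s:{a..<b}|stieltjes g. 1) = g b - g a" if "a \<le> b" for a b
    using set_integral_one[OF assms _ order_refl, of a b] measure_Ico_stieltjes[OF assms that] by simp
  then show ?thesis by (simp add: gintegral_def)
qed

text \<open>Up to a constant, \<open>g\<close> is the primitive of 1, so the formulas for primitives
  apply to \<open>g\<close> itself.\<close>

lemma extend_derivator:
  assumes "derivator g"
  shows "extend g y = extend (\<lambda>x. gintegral g 0 x (\<lambda>_. 1)) y + g 0"
proof (cases y)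
  case (PtR t)
  have "((\<lambda>x. gintegral g 0 x (\<lambda>_. 1) + g 0) \<longlongrightarrow>
      right_limit (\<lambda>x. gintegral g 0 x (\<lambda>_. 1)) t + g 0) (at_right t)"
    by (intro tendsto_intros tendsto_right_limit has_right_limits_gintegral assms
        locally_bounded_borel_const)
  then show ?thesis using PtR gintegral_one[OF assms] by (simp add: right_limit_eq)
qed (simp add: gintegral_one[OF assms])

lemma extend_derivator_diff:
  assumes "derivator g" "lower x \<subseteq> lower y"
  shows "extend g y - extend g x = measure (stieltjes g) (lower y - lower x)"
proof -
  have "(LINT s:(lower y - lower x)|stieltjes g. 1) = measure (stieltjes g) (lower y - lower x)"
    by (rule set_integral_one[OF assms(1) _ lower_diff_bounded]) measurable
  then show ?thesis
    using extend_gintegral_diff[OF assms(1) locally_bounded_borel_const assms(2), of 0 1]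
    by (simp add: extend_derivator[OF assms(1)])
qed

lemma extend_derivator_mono:
  "derivator g \<Longrightarrow> lower x \<subseteq> lower y \<Longrightarrow> extend g x \<le> extend g y"
  using extend_derivator_diff[of g x y] measure_nonneg[of "stieltjes g" "lower y - lower x"] by linarith

lemma gless_imp_lower_subset: "derivator g \<Longrightarrow> gless g x y \<Longrightarrow> lower x \<subseteq> lower y"
  using lower_total[of x y] extend_derivator_mono[of g y x] by (auto simp: gless_def)

lemma null_set_constancy:
  assumes g: "derivator g"
  shows "{s \<in> {..<b}. g s = g b} \<in> null_sets (stieltjes g)" (is "?N \<in> _")
proof -
  have mono: "g x \<le> g y" if "x \<le> y" for x y using g that by (auto simp: derivator_def mono_def)
  have null: "{s..<b} \<in> null_sets (stieltjes g)" if "s \<in> ?N" for s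
    using that emeasure_stieltjes[OF g, of s b] by (auto intro!: null_setsI)
  \<comment> \<open>Each \<open>{s..<b}\<close> with \<open>s\<close> in the set is null, and
    countably many of them must cover it. Rational \<open>s\<close> reach every point but a possible
    minimum, which \<open>Inf\<close> adds. Intersecting with the set makes \<open>Inf\<close>
    harmless when there is no minimum.\<close>
  define I where "I = ?N \<inter> (\<rat> \<union> {Inf ?N})"
  have "countable I" unfolding I_def by (intro countable_Int2) (simp add: countable_rat)
  then have "(\<Union>s\<in>I. {s..<b}) \<in> null_sets (stieltjes g)"
    using null by (intro null_sets_UN') (auto simp: I_def)
  moreover have "?N = (\<Union>s\<in>I. {s..<b})"
  proof (intro equalityI subsetI)
    fix x assume x: "x \<in> ?N"
    show "x \<in> (\<Union>s\<in>I. {s..<b})"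
    proof (cases "\<exists>y\<in>?N. y < x")
      case True
      then obtain y where y: "y \<in> ?N" "y < x" by blast
      obtain q where q: "q \<in> \<rat>" "y < q" "q < x" using Rats_dense_in_real[OF y(2)] by blast
      have "g q = g b" using mono[of y q] mono[of q b] y q x by auto
      then show ?thesis using q x by (intro UN_I[of q]) (auto simp: I_def)
    next
      case False
      then have "Inf ?N = x" using x by (intro cInf_eq_minimum) (auto simp: not_less)
      then show ?thesis using x by (intro UN_I[of x]) (auto simp: I_def)
    qed
  next
    fix x assume "x \<in> (\<Union>s\<in>I. {s..<b})"
    then obtain s where "s \<in> ?N" "s \<le> x" "x < b" by (auto simp: I_def)
    then show "x \<in> ?N" using mono[of s x] mono[of x b] by auto
  qed
  ultimately show ?thesis by simp
qed

text \<open>At a formal point the jump separates the level \<open>extend g y\<close> from all values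
  of \<open>g\<close> up to \<open>b\<close>, so nothing lies on it; at a real point it is a stretch
  of constancy.\<close>

lemma null_set_top_level:
  assumes g: "derivator g" and y: "y \<in> Rplus g"
  shows "{s \<in> lower y. g s = extend g y} \<in> null_sets (stieltjes g)"
proof (cases y)
  case (Pt b)
  then have "{s \<in> lower y. g s = extend g y} = {s \<in> {..<b}. g s = g b}" by auto
  then show ?thesis using null_set_constancy[OF g, of b] by metis
next
  case (PtR b)
  then have "g b < right_limit g b" using y by (auto simp: Rplus_def jumps_def)
  moreover have "g s \<le> g b" if "s \<le> b" for s using g that by (auto simp: derivator_def mono_def)
  ultimately have "{s \<in> lower y. g s = extend g y} = {}" using PtR by force
  then show ?thesis by (metis null_sets.empty_sets)
qed

text \<open>A mean value argument. If \<open>m\<close> were negative at all admissible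
  \<open>s\<close>, it would be negative almost everywhere on the difference set, as the top level
  is null. A nonnegative integral then makes this set null, although its measure is
  \<open>extend g y - extend g x > 0\<close>. The strict upper bound is what keeps intermediate
  points of consecutive intervals apart.\<close>

lemma exists_nonneg_of_integral_nonneg:
  assumes g: "derivator g" and m: "locally_bounded_borel m"
    and y: "y \<in> Rplus g" and xy: "gless g x y"
    and int: "(LINT s:(lower y - lower x)|stieltjes g. m s) \<ge> 0"
  shows "\<exists>s. extend g x \<le> g s \<and> g s < extend g y \<and> m s \<ge> 0"
proof (rule ccontr)
  assume none: "\<not> ?thesis"
  define D where "D = lower y - lower x"
  have D: "D \<in> sets borel" "D \<subseteq> {base x..<base y + 1}"
    unfolding D_def by (measurable, rule lower_diff_bounded)
  have "m s < 0" if s: "s \<in> D" "g s \<noteq> extend g y" for s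
  proof -
    have "extend g x \<le> g s" "g s \<le> extend g y"
      using extend_derivator_mono[OF g lower_subset_Pt[of s x]] extend_derivator_mono[OF g lower_Pt_subset[of s y]] s
      by (auto simp: D_def)
    then show ?thesis using none s(2) by force
  qed
  moreover have "AE s in stieltjes g. s \<notin> {s \<in> lower y. g s = extend g y}"
    by (rule AE_not_in[OF null_set_top_level[OF g y]])
  ultimately have neg: "AE s in stieltjes g. s \<in> D \<longrightarrow> m s < 0"
    by (elim AE_mp, intro AE_I2) (auto simp: D_def)
  have integrable: "integrable (stieltjes g) (\<lambda>s. - (indicat_real D s *\<^sub>R m s))"
    using set_integrable_locally_bounded(1)[OF g m D] unfolding set_integrable_def by simp
  have nonneg: "AE s in stieltjes g. 0 \<le> - (indicat_real D s *\<^sub>R m s)"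
    using neg by eventually_elim (auto simp: indicator_def)
  have "(LINT s|stieltjes g. - (indicat_real D s *\<^sub>R m s)) \<le> 0"
    using int unfolding D_def[symmetric] set_lebesgue_integral_def by simp
  moreover have "(LINT s|stieltjes g. - (indicat_real D s *\<^sub>R m s)) \<ge> 0"
    by (rule integral_nonneg_AE[OF nonneg])
  ultimately have "AE s in stieltjes g. - (indicat_real D s *\<^sub>R m s) = 0"
    using integral_nonneg_eq_0_iff_AE[OF integrable nonneg] by linarith
  with neg have "AE s in stieltjes g. s \<notin> D" by eventually_elim (auto simp: indicator_def)
  then have "measure (stieltjes g) D = 0"
    using D(1) by (simp add: AE_iff_null_sets[symmetric] null_sets_def measure_def)
  then show False
    using extend_derivator_diff[OF g gless_imp_lower_subset[OF g xy]] xy by (simp add: D_def gless_def)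
qed

section \<open>Regularity of the monomials\<close>

text \<open>On bounded intervals the increments of the primitive are dominated by those of
  \<open>g\<close>. It is thus continuous wherever \<open>g\<close> is, that is, outside a countable
  set, and this gives measurability.\<close>

lemma locally_bounded_borel_gintegral:
  assumes g: "derivator g" and m: "locally_bounded_borel m"
  shows "locally_bounded_borel (\<lambda>x. gintegral g x0 x m)"
proof -
  let ?M = "\<lambda>x. gintegral g x0 x m"
  have lipschitz: "\<exists>C\<ge>0. \<forall>x\<in>{a..b}. \<forall>y\<in>{a..b}. \<bar>?M y - ?M x\<bar> \<le> C * \<bar>g y - g x\<bar>" for a b
  proof -
    obtain C where C: "\<And>x. x \<in> {a..b} \<Longrightarrow> \<bar>m x\<bar> \<le> C"
      using m unfolding locally_bounded_borel_def by blast
    \<comment> \<open>An empty interval would allow a negative \<open>C\<close>, hence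
      \<open>max C 0\<close>.\<close>
    have le: "\<bar>?M y - ?M x\<bar> \<le> max C 0 * \<bar>g y - g x\<bar>" if "x \<in> {a..b}" "y \<in> {a..b}" "x \<le> y" for x y
    proof -
      have "\<bar>LINT s:{x..<y}|stieltjes g. m s\<bar> \<le> max C 0 * measure (stieltjes g) {x..<y}"
        using C that by (intro abs_set_integral_le[OF g m _ order_refl]) (auto simp: le_max_iff_disj)
      moreover have "measure (stieltjes g) {x..<y} \<le> \<bar>g y - g x\<bar>"
        using measure_Ico_stieltjes[OF g that(3)] by simp
      then have "max C 0 * measure (stieltjes g) {x..<y} \<le> max C 0 * \<bar>g y - g x\<bar>"
        by (intro mult_left_mono) auto
      ultimately show ?thesis unfolding gintegral_diff[OF g m that(3)] by linarith
    qed
    have "\<bar>?M y - ?M x\<bar> \<le> max C 0 * \<bar>g y - g x\<bar>" if "x \<in> {a..b}" "y \<in> {a..b}" for x y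
      using le[of x y] le[of y x] that by (cases "x \<le> y") (simp_all add: abs_minus_commute)
    then show ?thesis by (intro exI[of _ "max C 0"]) auto
  qed
  have "countable {t. \<not> isCont g t}" using g by (intro mono_ctble_discont) (simp add: derivator_def)
  moreover have "isCont ?M t" if t: "isCont g t" for t
  proof -
    obtain C where C: "\<forall>x\<in>{t - 1..t + 1}. \<forall>y\<in>{t - 1..t + 1}. \<bar>?M y - ?M x\<bar> \<le> C * \<bar>g y - g x\<bar>"
      using lipschitz by blast
    have "\<bar>?M x - ?M t\<bar> \<le> C * \<bar>g x - g t\<bar>" if "\<bar>x - t\<bar> < 1" for x
    proof -
      have "x \<in> {t - 1..t + 1}" using that unfolding atLeastAtMost_iff by linarith
      then show ?thesis using bspec[OF bspec[OF C, of t], of x] by simp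
    qed
    then have ev: "\<forall>\<^sub>F x in at t. norm (?M x - ?M t) \<le> norm (g x - g t) * C"
      unfolding eventually_at by (intro exI[of _ 1]) (auto simp: dist_real_def mult.commute)
    have "((\<lambda>x. g x - g t) \<longlongrightarrow> 0) (at t)" using t by (simp add: isCont_def LIM_zero)
    then have "((\<lambda>x. ?M x - ?M t) \<longlongrightarrow> 0) (at t)" by (rule tendsto_0_le[OF _ ev])
    then show ?thesis by (simp add: isCont_def LIM_zero_iff)
  qed
  then have "continuous_on (- {t. \<not> isCont g t}) ?M"
    by (intro continuous_at_imp_continuous_on) auto
  ultimately have "?M \<in> borel_measurable borel" by (rule borel_measurable_continuous_countable_exceptions)
  moreover have "\<exists>C. \<forall>x\<in>{a..b}. \<bar>?M x\<bar> \<le> C" for a b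
  proof -
    obtain C where C: "C \<ge> 0" "\<forall>x\<in>{a..b}. \<forall>y\<in>{a..b}. \<bar>?M y - ?M x\<bar> \<le> C * \<bar>g y - g x\<bar>"
      using lipschitz by blast
    have "\<bar>?M x\<bar> \<le> \<bar>?M a\<bar> + C * \<bar>g b - g a\<bar>" if x: "x \<in> {a..b}" for x
    proof -
      have "\<bar>?M x - ?M a\<bar> \<le> C * \<bar>g x - g a\<bar>" using C(2) x by auto
      also have "\<dots> \<le> C * \<bar>g b - g a\<bar>"
        using g x C(1) by (intro mult_left_mono) (auto simp: derivator_def mono_def)
      finally show ?thesis by linarith
    qed
    then show ?thesis by blast
  qed
  ultimately show ?thesis unfolding locally_bounded_borel_def by blast
qed

lemma locally_bounded_borel_cmult:
  assumes "locally_bounded_borel m"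
  shows "locally_bounded_borel (\<lambda>x. c * m x)"
proof -
  have "\<exists>C. \<forall>x\<in>{a..b}. \<bar>c * m x\<bar> \<le> C" for a b
  proof -
    obtain C where "\<forall>x\<in>{a..b}. \<bar>m x\<bar> \<le> C"
      using assms unfolding locally_bounded_borel_def by blast
    then have "\<forall>x\<in>{a..b}. \<bar>c * m x\<bar> \<le> \<bar>c\<bar> * C" by (auto simp: abs_mult intro!: mult_left_mono)
    then show ?thesis by blast
  qed
  then show ?thesis using assms by (auto simp: locally_bounded_borel_def)
qed

lemma locally_bounded_borel_add:
  assumes "locally_bounded_borel m" "locally_bounded_borel m'"
  shows "locally_bounded_borel (\<lambda>x. m x + m' x)"
proof -
  have "\<exists>C. \<forall>x\<in>{a..b}. \<bar>m x + m' x\<bar> \<le> C" for a b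
  proof -
    obtain C C' where C: "\<forall>x\<in>{a..b}. \<bar>m x\<bar> \<le> C" "\<forall>x\<in>{a..b}. \<bar>m' x\<bar> \<le> C'"
      using assms unfolding locally_bounded_borel_def by blast
    have "\<bar>m x + m' x\<bar> \<le> C + C'" if "x \<in> {a..b}" for x
      using bspec[OF C(1) that] bspec[OF C(2) that] by linarith
    then show ?thesis by blast
  qed
  then show ?thesis using assms by (auto simp: locally_bounded_borel_def)
qed

lemma locally_bounded_borel_sum:
  assumes "\<And>k. k \<in> I \<Longrightarrow> locally_bounded_borel (h k)"
  shows "locally_bounded_borel (\<lambda>x. \<Sum>k\<in>I. h k x)"
  using assms
  by (induction I rule: infinite_finite_induct)
    (auto intro: locally_bounded_borel_add locally_bounded_borel_const)

lemma locally_bounded_borel_gmonomial: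
  "derivator g \<Longrightarrow> locally_bounded_borel (gmonomial g x0 n)"
proof (induction n)
  case 0
  then show ?case by (simp add: locally_bounded_borel_const)
next
  case (Suc n)
  then have "locally_bounded_borel (\<lambda>x. gintegral g x0 x (gmonomial g x0 n))"
    by (intro locally_bounded_borel_gintegral)
  then show ?case by (simp only: gmonomial.simps) (rule locally_bounded_borel_cmult)
qed

lemma has_right_limits_gmonomial:
  "derivator g \<Longrightarrow> has_right_limits (gmonomial g x0 n)"
proof (cases n)
  case (Suc k)
  assume "derivator g"
  then show ?thesis unfolding Suc gmonomial.simps
    by (intro has_right_limits_cmult has_right_limits_gintegral locally_bounded_borel_gmonomial)
qed (auto simp: has_right_limits_def)

lemma extend_gmonomial_Suc_diff:
  assumes g: "derivator g" and xy: "lower x \<subseteq> lower y"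
  shows "extend (gmonomial g x0 (Suc n)) y - extend (gmonomial g x0 (Suc n)) x =
    real (Suc n) * (LINT s:(lower y - lower x)|stieltjes g. gmonomial g x0 n s)"
  unfolding gmonomial.simps
    extend_cmult[OF has_right_limits_gintegral[OF g locally_bounded_borel_gmonomial[OF g]]]
    extend_gintegral_diff[OF g locally_bounded_borel_gmonomial[OF g] xy, of x0, symmetric]
  by (simp only: right_diff_distrib)

section \<open>The monomials as a Chebyshev system\<close>

lemma set_integral_linear_combination:
  assumes "\<And>k. k \<in> I \<Longrightarrow> set_integrable M A (h k)"
  shows "(LINT x:A|M. (\<Sum>k\<in>I. c k * h k x)) = (\<Sum>k\<in>I. c k * (LINT x:A|M. h k x :: real))"
proof -
  have "integrable M (\<lambda>x. indicat_real A x *\<^sub>R (c k * h k x))" if "k \<in> I" for k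
    using set_integrable_mult_right[of "c k" M A "h k"] assms[OF that] by (simp add: set_integrable_def)
  then have "(LINT x:A|M. (\<Sum>k\<in>I. c k * h k x)) = (\<Sum>k\<in>I. (LINT x:A|M. c k * h k x))"
    unfolding set_lebesgue_integral_def scaleR_sum_right by (rule Bochner_Integration.integral_sum)
  then show ?thesis by simp
qed

text \<open>Rolle's argument: the differences of a weakly alternating combination integrate a
  combination of lower degree, which is weakly alternating at suitable intermediate points.\<close>

lemma gmonomials_no_weak_alternation:
  assumes g: "derivator g"
  shows "\<lbrakk>\<And>i. i \<le> Suc N \<Longrightarrow> t i \<in> Rplus g; \<And>i. i \<le> N \<Longrightarrow> gless g (t i) (t (Suc i));
    \<And>i. i \<le> Suc N \<Longrightarrow> (-1) ^ i * (\<Sum>k\<le>N. c k * extend (gmonomial g x0 k) (t i)) \<ge> 0; k \<le> N\<rbrakk>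
    \<Longrightarrow> c k = 0"
proof (induction N arbitrary: c t k)
  case 0
  from "0.prems"(3)[of 0] "0.prems"(3)[of 1] "0.prems"(4) show ?case by simp
next
  case (Suc N)
  define P where "P y = (\<Sum>k\<le>Suc N. c k * extend (gmonomial g x0 k) y)" for y
  \<comment> \<open>The factor \<open>Suc k\<close> comes from the recursion of the monomials. The
    minus sign makes \<open>m\<close> integrate to the decrement \<open>P x - P y\<close>, so that
    the signs start with plus again.\<close>
  define c' where "c' k = - (real (Suc k) * c (Suc k))" for k
  define m where "m s = (\<Sum>k\<le>N. c' k * gmonomial g x0 k s)" for s
  have m: "locally_bounded_borel m" unfolding m_def
    by (intro locally_bounded_borel_sum locally_bounded_borel_cmult locally_bounded_borel_gmonomial g)
  have P_diff: "P x - P y = (LINT s:(lower y - lower x)|stieltjes g. m s)" if "lower x \<subseteq> lower y" for x y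
  proof -
    have P: "P z = c 0 + (\<Sum>k\<le>N. c (Suc k) * extend (gmonomial g x0 (Suc k)) z)" for z
      unfolding P_def sum.atMost_Suc_shift by simp
    have "P y - P x = (\<Sum>k\<le>N. c (Suc k) *
        (extend (gmonomial g x0 (Suc k)) y - extend (gmonomial g x0 (Suc k)) x))"
      unfolding P by (simp add: right_diff_distrib sum_subtractf)
    also have "\<dots> = - (\<Sum>k\<le>N. c' k * (LINT s:(lower y - lower x)|stieltjes g. gmonomial g x0 k s))"
      unfolding extend_gmonomial_Suc_diff[OF g that] c'_def by (simp add: sum_negf mult_ac)
    also have "(\<Sum>k\<le>N. c' k * (LINT s:(lower y - lower x)|stieltjes g. gmonomial g x0 k s)) =
        (LINT s:(lower y - lower x)|stieltjes g. m s)"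
      unfolding m_def
      by (intro set_integral_linear_combination[symmetric] set_integrable_locally_bounded(1)[OF g _ _ lower_diff_bounded]
          locally_bounded_borel_gmonomial g) measurable
    finally show ?thesis by simp
  qed
  have "\<exists>s. extend g (t i) \<le> g s \<and> g s < extend g (t (Suc i)) \<and> (-1) ^ i * m s \<ge> 0" if i: "i \<le> Suc N" for i
  proof (rule exists_nonneg_of_integral_nonneg[OF g])
    show "locally_bounded_borel (\<lambda>s. (-1) ^ i * m s)" using m by (rule locally_bounded_borel_cmult)
    show "t (Suc i) \<in> Rplus g" using Suc.prems(1) i by simp
    show less: "gless g (t i) (t (Suc i))" using Suc.prems(2) i by simp
    have "(-1) ^ i * P (t i) \<ge> 0" "(-1) ^ Suc i * P (t (Suc i)) \<ge> 0"
      using Suc.prems(3)[of i] Suc.prems(3)[of "Suc i"] i unfolding P_def by simp_all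
    then have "(-1) ^ i * (P (t i) - P (t (Suc i))) \<ge> 0" by (simp add: right_diff_distrib)
    then show "(LINT s:(lower (t (Suc i)) - lower (t i))|stieltjes g. (-1) ^ i * m s) \<ge> 0"
      unfolding P_diff[OF gless_imp_lower_subset[OF g less]] by simp
  qed
  then obtain s where s: "\<And>i. i \<le> Suc N \<Longrightarrow>
      extend g (t i) \<le> g (s i) \<and> g (s i) < extend g (t (Suc i)) \<and> (-1) ^ i * m (s i) \<ge> 0"
    by metis
  have "c' k = 0" if "k \<le> N" for k
  \<comment> \<open>The \<open>N + 3\<close> points leave \<open>N + 2\<close> intermediate ones.
    These are real points, with values of \<open>g\<close> strictly increasing because
    \<open>g (s i) < extend g (t (Suc i)) \<le> g (s (Suc i))\<close>.\<close>
  proof (rule Suc.IH[where t = "\<lambda>i. Pt (s i)"])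
    show "Pt (s i) \<in> Rplus g" for i by (simp add: Rplus_def)
    show "gless g (Pt (s i)) (Pt (s (Suc i)))" if "i \<le> N" for i
      using s[of i] s[of "Suc i"] that by (auto simp: gless_def)
    show "(-1) ^ i * (\<Sum>k\<le>N. c' k * extend (gmonomial g x0 k) (Pt (s i))) \<ge> 0" if "i \<le> Suc N" for i
      using s[OF that] by (simp add: m_def)
  qed (use that in simp)
  then have higher: "c (Suc k) = 0" if "k \<le> N" for k using that by (force simp: c'_def)
  have "P y = c 0" for y unfolding P_def sum.atMost_Suc_shift using higher by simp
  then have "c 0 = 0"
    using Suc.prems(3)[of 0] Suc.prems(3)[of 1] unfolding P_def[symmetric] by simp
  then show ?case using higher[of "k - 1"] Suc.prems(4) by (cases k) auto
qed

section \<open>Lipschitz bounds in terms of \<open>g\<close> and the topology of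
  \<open>gdist\<close>\<close>

text \<open>Bounds are stated on ranges of values of \<open>g\<close>, not on intervals of the real
  line: a compact \<open>X\<close> may be unbounded on the line, but its image under
  \<open>extend g\<close> is bounded. All \<open>s\<close> in the domain of integration have values
  of \<open>g\<close> between those of the end points.\<close>

lemma gmonomial_Suc_lipschitz:
  assumes g: "derivator g"
    and bound: "\<And>x. extend g x \<in> {a..b} \<Longrightarrow> \<bar>extend (gmonomial g x0 k) x\<bar> \<le> C"
    and xy: "extend g x \<in> {a..b}" "extend g y \<in> {a..b}"
  shows "\<bar>extend (gmonomial g x0 (Suc k)) y - extend (gmonomial g x0 (Suc k)) x\<bar> \<le>
    real (Suc k) * C * \<bar>extend g y - extend g x\<bar>"
proof -
  have le: "\<bar>extend (gmonomial g x0 (Suc k)) y - extend (gmonomial g x0 (Suc k)) x\<bar> \<le>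
      real (Suc k) * C * \<bar>extend g y - extend g x\<bar>"
    if xy: "extend g x \<in> {a..b}" "extend g y \<in> {a..b}" "lower x \<subseteq> lower y" for x y
  proof -
    have "\<bar>LINT s:(lower y - lower x)|stieltjes g. gmonomial g x0 k s\<bar> \<le>
        C * measure (stieltjes g) (lower y - lower x)"
    proof (rule abs_set_integral_le[OF g locally_bounded_borel_gmonomial[OF g] _ lower_diff_bounded])
      fix s assume s: "s \<in> lower y - lower x"
      then have "extend g x \<le> g s" "g s \<le> extend g y"
        using extend_derivator_mono[OF g lower_subset_Pt[of s x]]
          extend_derivator_mono[OF g lower_Pt_subset[of s y]] by auto
      then show "\<bar>gmonomial g x0 k s\<bar> \<le> C" using bound[of "Pt s"] xy by auto
    qed measurable
    then have "real (Suc k) * \<bar>LINT s:(lower y - lower x)|stieltjes g. gmonomial g x0 k s\<bar> \<le>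
        real (Suc k) * (C * measure (stieltjes g) (lower y - lower x))"
      by (intro mult_left_mono) auto
    then show ?thesis
      unfolding extend_gmonomial_Suc_diff[OF g xy(3)] extend_derivator_diff[OF g xy(3)] abs_mult
      by (simp add: mult.assoc)
  qed
  show ?thesis
    using lower_total[of x y] le[of x y] le[of y x] xy by (auto simp only: abs_minus_commute)
qed

lemma gmonomial_bounded:
  assumes g: "derivator g"
  shows "\<exists>C\<ge>0. \<forall>x. extend g x \<in> {a..b} \<longrightarrow> \<bar>extend (gmonomial g x0 k) x\<bar> \<le> C"
proof (induction k)
  case 0
  show ?case by (intro exI[of _ 1]) simp
next
  case (Suc k)
  then obtain C where C: "C \<ge> 0" "\<And>x. extend g x \<in> {a..b} \<Longrightarrow> \<bar>extend (gmonomial g x0 k) x\<bar> \<le> C"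
    by blast
  show ?case
  proof (cases "\<exists>x. extend g x \<in> {a..b}")
    case True
    then obtain z where z: "extend g z \<in> {a..b}" by blast
    have "\<bar>extend (gmonomial g x0 (Suc k)) x\<bar> \<le>
        \<bar>extend (gmonomial g x0 (Suc k)) z\<bar> + real (Suc k) * C * (b - a)"
      if x: "extend g x \<in> {a..b}" for x
    proof -
      have "\<bar>extend (gmonomial g x0 (Suc k)) x - extend (gmonomial g x0 (Suc k)) z\<bar> \<le>
          real (Suc k) * C * \<bar>extend g x - extend g z\<bar>"
        by (rule gmonomial_Suc_lipschitz[OF g C(2) z x])
      also have "\<dots> \<le> real (Suc k) * C * (b - a)"
        using x z C(1) by (intro mult_left_mono) auto
      finally show ?thesis by linarith
    qed
    moreover have "0 \<le> \<bar>extend (gmonomial g x0 (Suc k)) z\<bar> + real (Suc k) * C * (b - a)"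
      using C(1) z by (intro add_nonneg_nonneg mult_nonneg_nonneg) auto
    ultimately show ?thesis by blast
  qed auto
qed

lemma gmonomial_lipschitz:
  assumes g: "derivator g"
  shows "\<exists>C\<ge>0. \<forall>x y. extend g x \<in> {a..b} \<longrightarrow> extend g y \<in> {a..b} \<longrightarrow>
    \<bar>extend (gmonomial g x0 k) y - extend (gmonomial g x0 k) x\<bar> \<le> C * \<bar>extend g y - extend g x\<bar>"
proof (cases k)
  case (Suc k')
  obtain C where C: "C \<ge> 0" "\<And>x. extend g x \<in> {a..b} \<Longrightarrow> \<bar>extend (gmonomial g x0 k') x\<bar> \<le> C"
    using gmonomial_bounded[OF g] by blast
  show ?thesis
    unfolding Suc using gmonomial_Suc_lipschitz[OF g C(2)] C(1)
    by (intro exI[of _ "real (Suc k') * C"]) auto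
qed auto

lemma continuous_map_extend: "continuous_map (gtopology g) euclideanreal (extend g)"
proof -
  have "openin (gtopology g) {x \<in> Rplus g. extend g x \<in> U}" if U: "open U" for U
    unfolding openin_gtopology
  proof (intro conjI ballI)
    fix x assume "x \<in> {x \<in> Rplus g. extend g x \<in> U}"
    then have "extend g x \<in> U" by simp
    then obtain e where "e > 0" "ball (extend g x) e \<subseteq> U" using U openE by blast
    then show "\<exists>e>0. \<forall>y\<in>Rplus g. gdist g x y < e \<longrightarrow> y \<in> {x \<in> Rplus g. extend g x \<in> U}"
      by (intro exI[of _ e]) (auto simp: gdist_def subset_iff dist_real_def)
  qed auto
  then show ?thesis by (simp add: continuous_map_def)
qed

lemma gcont_epsilon_delta:
  assumes f: "f \<in> gcont g X" and X: "X \<subseteq> Rplus g" and x: "x \<in> X" and e: "e > 0"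
  shows "\<exists>d>0. \<forall>y\<in>X. gdist g x y < d \<longrightarrow> \<bar>f y - f x\<bar> < e"
proof -
  have top: "topspace (subtopology (gtopology g) X) = X" using X by auto
  have "openin (subtopology (gtopology g) X) {y \<in> X. f y \<in> ball (f x) e}"
    using f unfolding gcont_def continuous_map_def top by auto
  then obtain T where T: "openin (gtopology g) T" "{y \<in> X. f y \<in> ball (f x) e} = T \<inter> X"
    unfolding openin_subtopology by blast
  have "x \<in> {y \<in> X. f y \<in> ball (f x) e}" using x e by simp
  then have "x \<in> T" unfolding T(2) by simp
  then obtain d where d: "d > 0" "\<forall>y\<in>Rplus g. gdist g x y < d \<longrightarrow> y \<in> T"
    using T(1) unfolding openin_gtopology by blast
  have "\<bar>f y - f x\<bar> < e" if "y \<in> X" "gdist g x y < d" for y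
  proof -
    have "y \<in> T \<inter> X" using d(2) X that by auto
    then have "f y \<in> ball (f x) e" unfolding T(2)[symmetric] by simp
    then show ?thesis by (simp add: dist_real_def abs_minus_commute)
  qed
  then show ?thesis using d(1) by blast
qed

theorem theorem6p21:
  fixes g :: "real \<Rightarrow> real" and x0 :: real and X :: "rpoint set" and n :: nat
    and f :: "rpoint \<Rightarrow> real" and p :: "real \<Rightarrow> real"
  assumes "derivator g"
    and "compactin (gtopology g) X"
    and "infinite (extend g ` X) \<or> card (extend g ` X) \<ge> n + 2"
    and "f \<in> gcont g X"
    and "p \<in> g_polynomials g x0 n"
  shows "best_approximation g x0 n X f p \<longleftrightarrow>
    (\<exists>t :: nat \<Rightarrow> rpoint.
      (\<forall>i\<in>{1..n+2}. t i \<in> X) \<and>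
      (\<forall>i\<in>{1..n+1}. gless g (t i) (t (i + 1))) \<and>
      (\<forall>i\<in>{1..n+2}. \<bar>f (t i) - extend p (t i)\<bar> = sup_norm X (\<lambda>x. f x - extend p x)) \<and>
      (\<forall>i\<in>{1..n+1}. f (t i) - extend p (t i) = - (f (t (i + 1)) - extend p (t (i + 1)))))"
    (is "_ \<longleftrightarrow> ?alt")
proof -
  note g = assms(1)
  have X: "X \<subseteq> Rplus g" using compactin_subset_topspace[OF assms(2)] by simp
  define Y where "Y = extend g ` X"
  have Y: "compact Y"
    using image_compactin[OF assms(2) continuous_map_extend] by (simp add: Y_def compactin_euclidean_iff)
  \<comment> \<open>\<open>\<rho>\<close> selects one representative for each value of
    \<open>g\<close>. The choice is immaterial: points at \<open>gdist\<close> zero give the same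
    monomials by the Lipschitz bound and the same \<open>f\<close> by continuity.\<close>
  define \<rho> where "\<rho> = inv_into X (extend g)"
  have \<rho>: "\<rho> y \<in> X" "extend g (\<rho> y) = y" if "y \<in> Y" for y
    using that by (auto simp: \<rho>_def Y_def inv_into_into f_inv_into_f)
  define U where "U k y = extend (gmonomial g x0 k) (\<rho> y)" for k y
  define F where "F y = f (\<rho> y)" for y
  have "bounded Y" using Y by (rule compact_imp_bounded)
  then obtain B where B: "\<And>y. y \<in> Y \<Longrightarrow> \<bar>y\<bar> \<le> B" unfolding bounded_real by blast
  have range: "extend g x \<in> {- B..B}" if "x \<in> X" for x
    using B[of "extend g x"] that by (auto simp: Y_def abs_le_iff)
  have lip: "\<exists>C\<ge>0. \<forall>x\<in>X. \<forall>y\<in>X. \<bar>extend (gmonomial g x0 k) y - extend (gmonomial g x0 k) x\<bar> \<le>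
      C * \<bar>extend g y - extend g x\<bar>" for k
    using gmonomial_lipschitz[OF g, of "- B" B x0 k] range by blast
  have U_extend: "extend (gmonomial g x0 k) x = U k (extend g x)" if x: "x \<in> X" for k x
    using lip[of k] \<rho>[of "extend g x"] x by (force simp: U_def Y_def)
  have F_extend: "f x = F (extend g x)" if x: "x \<in> X" for x
  proof (rule ccontr)
    assume ne: "f x \<noteq> F (extend g x)"
    have r: "\<rho> (extend g x) \<in> X" "gdist g x (\<rho> (extend g x)) = 0"
      using \<rho>[of "extend g x"] x by (auto simp: Y_def gdist_def)
    show False
      using gcont_epsilon_delta[OF assms(4) X x, of "\<bar>f x - F (extend g x)\<bar>"] ne r
      by (auto simp: F_def abs_minus_commute)
  qed
  have F: "continuous_on Y F"
    unfolding continuous_on_iff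
  proof (intro ballI allI impI)
    fix y e :: real assume y: "y \<in> Y" and e: "e > 0"
    obtain d where d: "d > 0" "\<forall>z\<in>X. gdist g (\<rho> y) z < d \<longrightarrow> \<bar>f z - f (\<rho> y)\<bar> < e"
      using gcont_epsilon_delta[OF assms(4) X \<rho>(1)[OF y] e] by blast
    have "dist (F z) (F y) < e" if "z \<in> Y" "dist z y < d" for z
      using d(2) \<rho>[OF that(1)] \<rho>[OF y] that(2)
      by (auto simp: F_def gdist_def dist_real_def abs_minus_commute)
    then show "\<exists>d>0. \<forall>z\<in>Y. dist z y < d \<longrightarrow> dist (F z) (F y) < e" using d(1) by blast
  qed
  interpret chebyshev_system Y U n
  proof
    show "compact Y" by (rule Y)
    show "infinite Y \<or> card Y \<ge> n + 2" using assms(3) by (simp add: Y_def)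
    show "continuous_on Y (U k)" if "k \<le> n" for k
    proof -
      obtain C where C: "C \<ge> 0" "\<forall>x\<in>X. \<forall>y\<in>X. \<bar>extend (gmonomial g x0 k) y - extend (gmonomial g x0 k) x\<bar> \<le>
          C * \<bar>extend g y - extend g x\<bar>" using lip by blast
      have "C-lipschitz_on Y (U k)"
      proof (rule lipschitz_onI[OF _ C(1)])
        fix x y assume "x \<in> Y" "y \<in> Y"
        then show "dist (U k x) (U k y) \<le> C * dist x y"
          using bspec[OF bspec[OF C(2), of "\<rho> y"], of "\<rho> x"] \<rho>[of x] \<rho>[of y]
          by (simp add: U_def dist_real_def)
      qed
      then show ?thesis by (rule lipschitz_on_continuous_on)
    qed
  next
    fix m t c k
    assume t: "\<And>i. i \<le> Suc m \<Longrightarrow> t i \<in> Y" "\<And>i. i \<le> m \<Longrightarrow> t i < t (Suc i)"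
      "\<And>i. i \<le> Suc m \<Longrightarrow> (-1) ^ i * (\<Sum>k\<le>m. c k * U k (t i)) \<ge> 0" and k: "k \<le> m"
    show "c k = 0"
    proof (rule gmonomials_no_weak_alternation[OF g, where t = "\<lambda>i. \<rho> (t i)"])
      show "\<rho> (t i) \<in> Rplus g" if "i \<le> Suc m" for i using \<rho>(1) t(1) X that by blast
      show "gless g (\<rho> (t i)) (\<rho> (t (Suc i)))" if "i \<le> m" for i
        using \<rho>(2)[OF t(1)] t(2) that by (simp add: gless_def)
      show "(-1) ^ i * (\<Sum>k\<le>m. c k * extend (gmonomial g x0 k) (\<rho> (t i))) \<ge> 0" if "i \<le> Suc m" for i
        using t(3)[OF that] by (simp add: U_def)
    qed (rule k)
  qed
  define poly where "poly d = (\<lambda>x. \<Sum>k\<le>n. d k * gmonomial g x0 k x)" for d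
  define err where "err d = (SUP y\<in>Y. \<bar>F y - comb n d y\<bar>)" for d
  have polys: "g_polynomials g x0 n = range poly" by (auto simp: g_polynomials_def poly_def)
  have poly_extend: "extend (poly d) x = comb n d (extend g x)" if x: "x \<in> X" for d x
  proof -
    have "extend (poly d) x = (\<Sum>k\<le>n. d k * extend (gmonomial g x0 k) x)"
      unfolding poly_def
      by (simp add: extend_sum extend_cmult has_right_limits_cmult has_right_limits_gmonomial[OF g])
    then show ?thesis using U_extend[OF x] by (simp add: comb_def)
  qed
  have sup_norm: "sup_norm X (\<lambda>x. f x - extend (poly d) x) = err d" for d
    unfolding sup_norm_def err_def Y_def image_image
    by (intro arg_cong[where f = Sup] image_cong refl) (simp add: poly_extend F_extend[symmetric])
  obtain c where p: "p = poly c" using assms(5) polys by blast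
  obtain y0 where "y0 \<in> Y" using exists_outside[of "{}"] by auto
  then have "err d \<ge> 0" for d
    using abs_le_err[OF F, of y0 d] unfolding err_def by (meson abs_ge_zero order_trans)
  \<comment> \<open>A real \<open>INF\<close> is a lower bound only for a family bounded
    below.\<close>
  then have bdd: "bdd_below (range err)" by (auto intro: bdd_belowI[of _ 0])
  have "best_approximation g x0 n X f p \<longleftrightarrow> err c = (INF d. err d)"
    unfolding best_approximation_def polys p image_image sup_norm ..
  also have "\<dots> \<longleftrightarrow> (\<forall>d. err c \<le> err d)"
  proof
    assume "err c = (INF d. err d)"
    then show "\<forall>d. err c \<le> err d" using cINF_lower[OF bdd] by simp
  next
    assume "\<forall>d. err c \<le> err d"
    then show "err c = (INF d. err d)"
      using cINF_lower[OF bdd, of c] by (intro antisym cINF_greatest) auto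
  qed
  also have "\<dots> \<longleftrightarrow> (\<exists>t. (\<forall>i\<le>Suc n. t i \<in> Y) \<and> (\<forall>i\<le>n. t i < t (Suc i)) \<and>
      (\<forall>i\<le>Suc n. \<bar>F (t i) - comb n c (t i)\<bar> = err c) \<and>
      (\<forall>i\<le>n. F (t i) - comb n c (t i) = - (F (t (Suc i)) - comb n c (t (Suc i)))))"
    unfolding err_def by (rule alternation_theorem[OF F])
  also have "\<dots> \<longleftrightarrow> ?alt" (is "?alt' \<longleftrightarrow> _")
  proof
    assume ?alt'
    then obtain t where t: "\<And>i. i \<le> Suc n \<Longrightarrow> t i \<in> Y" "\<And>i. i \<le> n \<Longrightarrow> t i < t (Suc i)"
      "\<And>i. i \<le> Suc n \<Longrightarrow> \<bar>F (t i) - comb n c (t i)\<bar> = err c"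
      "\<And>i. i \<le> n \<Longrightarrow> F (t i) - comb n c (t i) = - (F (t (Suc i)) - comb n c (t (Suc i)))"
      by blast
    have res: "f (\<rho> (t i)) - extend p (\<rho> (t i)) = F (t i) - comb n c (t i)" if "i \<le> Suc n" for i
      using poly_extend[OF \<rho>(1)[OF t(1)[OF that]]] \<rho>(2)[OF t(1)[OF that]] by (simp add: p F_def)
    \<comment> \<open>Positions start at 0 in the locale and at 1 in the theorem;
      \<open>i - 1\<close> is a true difference because \<open>i\<close> is at least 1.\<close>
    show ?alt
    proof (intro exI[of _ "\<lambda>i. \<rho> (t (i - 1))"] conjI ballI)
      fix i assume i: "i \<in> {1..n+2}"
      then have i': "i - 1 \<le> Suc n" by auto
      show "\<rho> (t (i - 1)) \<in> X" using \<rho>(1)[OF t(1)[OF i']] .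
      show "\<bar>f (\<rho> (t (i - 1))) - extend p (\<rho> (t (i - 1)))\<bar> = sup_norm X (\<lambda>x. f x - extend p x)"
        unfolding res[OF i'] unfolding p sup_norm by (rule t(3)[OF i'])
    next
      fix i assume i: "i \<in> {1..n+1}"
      then have i': "i - 1 \<le> n" "i - 1 \<le> Suc n" "i \<le> Suc n" and Suc: "Suc (i - 1) = i" by auto
      show "gless g (\<rho> (t (i - 1))) (\<rho> (t (i + 1 - 1)))"
        using t(2)[OF i'(1)] \<rho>(2)[OF t(1)[OF i'(2)]] \<rho>(2)[OF t(1)[OF i'(3)]]
        by (simp add: gless_def Suc del: One_nat_def)
      show "f (\<rho> (t (i - 1))) - extend p (\<rho> (t (i - 1))) =
          - (f (\<rho> (t (i + 1 - 1))) - extend p (\<rho> (t (i + 1 - 1))))"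
        using t(4)[OF i'(1)] unfolding add_diff_cancel_right' res[OF i'(2)] res[OF i'(3)] Suc .
    qed
  next
    assume ?alt
    then obtain t where t: "\<forall>i\<in>{1..n+2}. t i \<in> X" "\<forall>i\<in>{1..n+1}. gless g (t i) (t (i + 1))"
      "\<forall>i\<in>{1..n+2}. \<bar>f (t i) - extend p (t i)\<bar> = sup_norm X (\<lambda>x. f x - extend p x)"
      "\<forall>i\<in>{1..n+1}. f (t i) - extend p (t i) = - (f (t (i + 1)) - extend p (t (i + 1)))"
      by blast
    have tX: "t (Suc i) \<in> X" if "i \<le> Suc n" for i using t(1) that by auto
    have res: "F (extend g (t (Suc i))) - comb n c (extend g (t (Suc i))) =
        f (t (Suc i)) - extend p (t (Suc i))" if "i \<le> Suc n" for i
      using poly_extend[OF tX[OF that]] F_extend[OF tX[OF that]] by (simp add: p)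
    show ?alt'
    proof (intro exI[of _ "\<lambda>i. extend g (t (Suc i))"] conjI allI impI)
      fix i assume i: "i \<le> Suc n"
      show "extend g (t (Suc i)) \<in> Y" using tX[OF i] by (simp add: Y_def)
      show "\<bar>F (extend g (t (Suc i))) - comb n c (extend g (t (Suc i)))\<bar> = err c"
        unfolding res[OF i] sup_norm[symmetric] using t(3) i by (auto simp: p)
    next
      fix i assume i: "i \<le> n"
      then show "extend g (t (Suc i)) < extend g (t (Suc (Suc i)))"
        using bspec[OF t(2), of "Suc i"] by (simp add: gless_def)
      show "F (extend g (t (Suc i))) - comb n c (extend g (t (Suc i))) =
          - (F (extend g (t (Suc (Suc i)))) - comb n c (extend g (t (Suc (Suc i)))))"
        using bspec[OF t(4), of "Suc i"] i res[of i] res[of "Suc i"] by simp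
    qed
  qed
  finally show ?thesis .
qed

end
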